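(* There exists a universal constant $C > 0$ such that the following holds. Let $\varphi$ be a satisfiable equality-free sentence of the Triguarded Fragment $\mathrm{TGF}$. Then $\varphi$ has a finite model whose domain size is at most $2^{2^{\,C \cdot |\varphi|\cdot\log|\varphi|}}$.
   Context: First-order logic with relation and constant symbols, no function symbols. The Triguarded Fragment $\mathrm{TGF}$ is the smallest set of first-order formulas such that: (i) every atomic formula is in $\mathrm{TGF}$; (ii) $\mathrm{TGF}$ is closed under Boolean connectives; (iii) if $\bar x$ is a tuple of variables, $\psi\in\mathrm{TGF}$ and $\gamma$ is an atomic formula containing all variables of $\bar x$ and all free variables of $\psi$, then $\exists\bar x(\gamma\wedge\psi)$ and $\forall\bar x(\gamma\to\psi)$ are in $\mathrm{TGF}$; (iv) if $x,y$ are variables and $\psi\in\mathrm{TGF}$ has free variables among $\{x,y\}$, then $\exists x\,\psi$ and $\forall x\,\psi$ are in $\mathrm{TGF}$. A formula is equality-free if it does not use the equality symbol. The length $|\varphi|$ is the uniform length: each occurrence of a symbol (parenthesis, connective, quantifier, variable, relation symbol, constant) contributes $1$. *)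

theory Defs
  imports Complex_Main "HOL-Library.Countable_Set"
begin

type_synonym var = nat

datatype trm = Var var | Const nat

datatype fm =
    Rel nat "trm list"
  | Eq trm trm
  | Neg fm
  | Conj fm fm
  | Disj fm fm
  | Imp fm fm
  | Iff fm fm
  | Exists var fm
  | Forall var fm

fun vars_trm :: "trm \<Rightarrow> var set" where
  "vars_trm (Var x) = {x}"
| "vars_trm (Const c) = {}"

fun fv :: "fm \<Rightarrow> var set" where
  "fv (Rel R ts) = (\<Union>t\<in>set ts. vars_trm t)"
| "fv (Eq s t) = vars_trm s \<union> vars_trm t"
| "fv (Neg \<phi>) = fv \<phi>"
| "fv (Conj \<phi> \<psi>) = fv \<phi> \<union> fv \<psi>"
| "fv (Disj \<phi> \<psi>) = fv \<phi> \<union> fv \<psi>"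
| "fv (Imp \<phi> \<psi>) = fv \<phi> \<union> fv \<psi>"
| "fv (Iff \<phi> \<psi>) = fv \<phi> \<union> fv \<psi>"
| "fv (Exists x \<phi>) = fv \<phi> - {x}"
| "fv (Forall x \<phi>) = fv \<phi> - {x}"

definition sentence :: "fm \<Rightarrow> bool" where
  "sentence \<phi> \<longleftrightarrow> fv \<phi> = {}"

fun atomic :: "fm \<Rightarrow> bool" where
  "atomic (Rel R ts) = True"
| "atomic (Eq s t) = True"
| "atomic _ = False"

fun respects_arity :: "(nat \<Rightarrow> nat) \<Rightarrow> fm \<Rightarrow> bool" where
  "respects_arity ar (Rel R ts) \<longleftrightarrow> length ts = ar R"
| "respects_arity ar (Eq s t) \<longleftrightarrow> True"
| "respects_arity ar (Neg \<phi>) \<longleftrightarrow> respects_arity ar \<phi>"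
| "respects_arity ar (Conj \<phi> \<psi>) \<longleftrightarrow> respects_arity ar \<phi> \<and> respects_arity ar \<psi>"
| "respects_arity ar (Disj \<phi> \<psi>) \<longleftrightarrow> respects_arity ar \<phi> \<and> respects_arity ar \<psi>"
| "respects_arity ar (Imp \<phi> \<psi>) \<longleftrightarrow> respects_arity ar \<phi> \<and> respects_arity ar \<psi>"
| "respects_arity ar (Iff \<phi> \<psi>) \<longleftrightarrow> respects_arity ar \<phi> \<and> respects_arity ar \<psi>"
| "respects_arity ar (Exists x \<phi>) \<longleftrightarrow> respects_arity ar \<phi>"
| "respects_arity ar (Forall x \<phi>) \<longleftrightarrow> respects_arity ar \<phi>"

fun equality_free :: "fm \<Rightarrow> bool" where
  "equality_free (Rel R ts) \<longleftrightarrow> True"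
| "equality_free (Eq s t) \<longleftrightarrow> False"
| "equality_free (Neg \<phi>) \<longleftrightarrow> equality_free \<phi>"
| "equality_free (Conj \<phi> \<psi>) \<longleftrightarrow> equality_free \<phi> \<and> equality_free \<psi>"
| "equality_free (Disj \<phi> \<psi>) \<longleftrightarrow> equality_free \<phi> \<and> equality_free \<psi>"
| "equality_free (Imp \<phi> \<psi>) \<longleftrightarrow> equality_free \<phi> \<and> equality_free \<psi>"
| "equality_free (Iff \<phi> \<psi>) \<longleftrightarrow> equality_free \<phi> \<and> equality_free \<psi>"
| "equality_free (Exists x \<phi>) \<longleftrightarrow> equality_free \<phi>"
| "equality_free (Forall x \<phi>) \<longleftrightarrow> equality_free \<phi>"

text \<open>A block of quantifiers over a tuple \<open>xs\<close> is the iterated quantifier \<open>foldr Exists xs\<close>.\<close>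

inductive_set TGF :: "fm set" where
  atom: "atomic \<phi> \<Longrightarrow> \<phi> \<in> TGF"
| neg: "\<phi> \<in> TGF \<Longrightarrow> Neg \<phi> \<in> TGF"
| conj: "\<phi> \<in> TGF \<Longrightarrow> \<psi> \<in> TGF \<Longrightarrow> Conj \<phi> \<psi> \<in> TGF"
| disj: "\<phi> \<in> TGF \<Longrightarrow> \<psi> \<in> TGF \<Longrightarrow> Disj \<phi> \<psi> \<in> TGF"
| imp: "\<phi> \<in> TGF \<Longrightarrow> \<psi> \<in> TGF \<Longrightarrow> Imp \<phi> \<psi> \<in> TGF"
| iff: "\<phi> \<in> TGF \<Longrightarrow> \<psi> \<in> TGF \<Longrightarrow> Iff \<phi> \<psi> \<in> TGF"
| guarded_ex: "\<psi> \<in> TGF \<Longrightarrow> atomic \<gamma> \<Longrightarrow> set xs \<union> fv \<psi> \<subseteq> fv \<gamma> \<Longrightarrow> foldr Exists xs (Conj \<gamma> \<psi>) \<in> TGF"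
| guarded_all: "\<psi> \<in> TGF \<Longrightarrow> atomic \<gamma> \<Longrightarrow> set xs \<union> fv \<psi> \<subseteq> fv \<gamma> \<Longrightarrow> foldr Forall xs (Imp \<gamma> \<psi>) \<in> TGF"
| two_var_ex: "\<psi> \<in> TGF \<Longrightarrow> fv \<psi> \<subseteq> {x, y} \<Longrightarrow> Exists x \<psi> \<in> TGF"
| two_var_all: "\<psi> \<in> TGF \<Longrightarrow> fv \<psi> \<subseteq> {x, y} \<Longrightarrow> Forall x \<psi> \<in> TGF"

text \<open>
  Uniform length of the fully parenthesised notation: an atom is written \<open>R(t\<^sub>1 \<dots> t\<^sub>k)\<close> or
  \<open>s = t\<close>, a binary compound \<open>(\<phi> \<circ> \<psi>)\<close>, a negation \<open>\<not>\<phi>\<close> and a quantification \<open>Qx \<phi>\<close>.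
\<close>

fun fm_length :: "fm \<Rightarrow> nat" where
  "fm_length (Rel R ts) = length ts + 3"
| "fm_length (Eq s t) = 3"
| "fm_length (Neg \<phi>) = fm_length \<phi> + 1"
| "fm_length (Conj \<phi> \<psi>) = fm_length \<phi> + fm_length \<psi> + 3"
| "fm_length (Disj \<phi> \<psi>) = fm_length \<phi> + fm_length \<psi> + 3"
| "fm_length (Imp \<phi> \<psi>) = fm_length \<phi> + fm_length \<psi> + 3"
| "fm_length (Iff \<phi> \<psi>) = fm_length \<phi> + fm_length \<psi> + 3"
| "fm_length (Exists x \<phi>) = fm_length \<phi> + 2"
| "fm_length (Forall x \<phi>) = fm_length \<phi> + 2"

record 'a struct =
  universe :: "'a set"
  rel_of :: "nat \<Rightarrow> 'a list set"
  const_of :: "nat \<Rightarrow> 'a"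

definition is_struct :: "(nat \<Rightarrow> nat) \<Rightarrow> 'a struct \<Rightarrow> bool" where
  "is_struct ar M \<longleftrightarrow>
     universe M \<noteq> {} \<and>
     (\<forall>R. rel_of M R \<subseteq> {as. length as = ar R \<and> set as \<subseteq> universe M}) \<and>
     (\<forall>c. const_of M c \<in> universe M)"

fun val :: "'a struct \<Rightarrow> (var \<Rightarrow> 'a) \<Rightarrow> trm \<Rightarrow> 'a" where
  "val M e (Var x) = e x"
| "val M e (Const c) = const_of M c"

fun sat :: "'a struct \<Rightarrow> (var \<Rightarrow> 'a) \<Rightarrow> fm \<Rightarrow> bool" where
  "sat M e (Rel R ts) \<longleftrightarrow> map (val M e) ts \<in> rel_of M R"
| "sat M e (Eq s t) \<longleftrightarrow> val M e s = val M e t"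
| "sat M e (Neg \<phi>) \<longleftrightarrow> \<not> sat M e \<phi>"
| "sat M e (Conj \<phi> \<psi>) \<longleftrightarrow> sat M e \<phi> \<and> sat M e \<psi>"
| "sat M e (Disj \<phi> \<psi>) \<longleftrightarrow> sat M e \<phi> \<or> sat M e \<psi>"
| "sat M e (Imp \<phi> \<psi>) \<longleftrightarrow> (sat M e \<phi> \<longrightarrow> sat M e \<psi>)"
| "sat M e (Iff \<phi> \<psi>) \<longleftrightarrow> (sat M e \<phi> \<longleftrightarrow> sat M e \<psi>)"
| "sat M e (Exists x \<phi>) \<longleftrightarrow> (\<exists>a\<in>universe M. sat M (e(x := a)) \<phi>)"
| "sat M e (Forall x \<phi>) \<longleftrightarrow> (\<forall>a\<in>universe M. sat M (e(x := a)) \<phi>)"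

definition is_model :: "(nat \<Rightarrow> nat) \<Rightarrow> 'a struct \<Rightarrow> fm \<Rightarrow> bool" where
  "is_model ar M \<phi> \<longleftrightarrow>
     is_struct ar M \<and> (\<forall>e. range e \<subseteq> universe M \<longrightarrow> sat M e \<phi>)"

text \<open>
  HOL cannot quantify over the type of the domain inside a formula. By the downward
  Loewenheim-Skolem theorem, proved below as
  \<open>is_model_imp_satisfiable\<close>, domains in \<open>nat\<close> lose nothing: a formula with a model over any
  type whatsoever is satisfiable in the following sense.
\<close>

definition satisfiable :: "(nat \<Rightarrow> nat) \<Rightarrow> fm \<Rightarrow> bool" where
  "satisfiable ar \<phi> \<longleftrightarrow> (\<exists>M :: nat struct. is_model ar M \<phi>)"

instance trm :: countable by countable_datatype
instance fm :: countable by countable_datatype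

lemma sat_cong:
  assumes "\<forall>x\<in>fv \<phi>. e x = e' x"
  shows "sat M e \<phi> \<longleftrightarrow> sat M e' \<phi>"
  using assms
proof (induction \<phi> arbitrary: e e')
  case (Rel R ts)
  have "val M e t = val M e' t" if "t \<in> set ts" for t
    using Rel that by (cases t) force+
  then have "map (val M e) ts = map (val M e') ts" by simp
  then show ?case by (simp only: sat.simps)
next
  case (Eq s t)
  then show ?case by (cases s; cases t) auto
next
  case (Neg \<phi>)
  then show ?case by (metis sat.simps(3) fv.simps(3))
next
  case (Conj \<phi> \<psi>)
  then show ?case by (metis sat.simps(4) fv.simps(4) UnCI)
next
  case (Disj \<phi> \<psi>)
  then show ?case by (metis sat.simps(5) fv.simps(5) UnCI)
next
  case (Imp \<phi> \<psi>)
  then show ?case by (metis sat.simps(6) fv.simps(6) UnCI)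
next
  case (Iff \<phi> \<psi>)
  then show ?case by (metis sat.simps(7) fv.simps(7) UnCI)
next
  case (Exists x \<phi>)
  have "sat M (e(x := a)) \<phi> \<longleftrightarrow> sat M (e'(x := a)) \<phi>" for a
    using Exists.prems by (intro Exists.IH) auto
  then show ?case by simp
next
  case (Forall x \<phi>)
  have "sat M (e(x := a)) \<phi> \<longleftrightarrow> sat M (e'(x := a)) \<phi>" for a
    using Forall.prems by (intro Forall.IH) auto
  then show ?case by simp
qed

lemma finite_fv: "finite (fv \<phi>)"
proof -
  have "finite (vars_trm t)" for t by (cases t) auto
  then show ?thesis by (induction \<phi>) auto
qed

text \<open>Terms naming the elements of the Skolem hull of the constants and a base point.\<close>

datatype hull_term = Base | HConst nat | Wit fm var "hull_term list"

instance hull_term :: countable by countable_datatype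

definition list_env :: "'a \<Rightarrow> 'a list \<Rightarrow> var \<Rightarrow> 'a" where
  "list_env d as x = (if x < length as then as ! x else d)"

definition witness :: "'a struct \<Rightarrow> 'a \<Rightarrow> fm \<Rightarrow> var \<Rightarrow> (var \<Rightarrow> 'a) \<Rightarrow> 'a" where
  "witness M d \<phi> x e =
     (if \<exists>a\<in>universe M. sat M (e(x := a)) \<phi>
      then SOME a. a \<in> universe M \<and> sat M (e(x := a)) \<phi> else d)"

primrec hull_val :: "'a struct \<Rightarrow> 'a \<Rightarrow> hull_term \<Rightarrow> 'a" where
  "hull_val M d Base = d"
| "hull_val M d (HConst c) = const_of M c"
| "hull_val M d (Wit \<phi> x hs) = witness M d \<phi> x (list_env d (map (hull_val M d) hs))"

lemma witness:
  assumes "d \<in> universe M"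
  shows "witness M d \<phi> x e \<in> universe M"
    and "\<exists>a\<in>universe M. sat M (e(x := a)) \<phi> \<Longrightarrow> sat M (e(x := witness M d \<phi> x e)) \<phi>"
proof -
  have *: "witness M d \<phi> x e \<in> universe M \<and> sat M (e(x := witness M d \<phi> x e)) \<phi>"
    if "\<exists>a\<in>universe M. sat M (e(x := a)) \<phi>"
    using that someI_ex[of "\<lambda>a. a \<in> universe M \<and> sat M (e(x := a)) \<phi>"]
    by (auto simp: witness_def)
  then show "\<exists>a\<in>universe M. sat M (e(x := a)) \<phi> \<Longrightarrow> sat M (e(x := witness M d \<phi> x e)) \<phi>"
    by blast
  show "witness M d \<phi> x e \<in> universe M"
    using * assms by (cases "\<exists>a\<in>universe M. sat M (e(x := a)) \<phi>") (auto simp: witness_def)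
qed

lemma hull_closed:
  assumes d: "d \<in> universe M" and e: "range e \<subseteq> range (hull_val M d)"
    and ex: "\<exists>a\<in>universe M. sat M (e(x := a)) \<phi>"
  shows "\<exists>a\<in>range (hull_val M d). sat M (e(x := a)) \<phi>"
proof -
  obtain n where n: "\<forall>y\<in>fv \<phi>. y < n"
    using finite_fv[of \<phi>] finite_nat_set_iff_bounded by auto
  have "\<forall>y. \<exists>h. e y = hull_val M d h" using e by blast
  then obtain h where h: "\<And>y. e y = hull_val M d (h y)" by metis
  define e' where "e' = list_env d (map (hull_val M d) (map h [0..<n]))"
  have agree: "e' y = e y" if "y \<in> fv \<phi>" for y
    using n that by (simp add: e'_def list_env_def h)
  have cong: "sat M (e(x := a)) \<phi> \<longleftrightarrow> sat M (e'(x := a)) \<phi>" for a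
    by (rule sat_cong) (simp add: agree)
  have "sat M (e'(x := hull_val M d (Wit \<phi> x (map h [0..<n])))) \<phi>"
    using witness(2)[OF d, of e' x \<phi>] ex cong by (simp add: e'_def)
  then show ?thesis using cong by blast
qed

lemma is_model_imp_satisfiable:
  fixes M :: "'a struct"
  assumes "is_model ar M \<phi>"
  shows "satisfiable ar \<phi>"
proof -
  have M: "is_struct ar M" and holds: "\<And>e. range e \<subseteq> universe M \<Longrightarrow> sat M e \<phi>"
    using assms by (auto simp: is_model_def)
  obtain d where d: "d \<in> universe M" using M by (auto simp: is_struct_def)
  define S where "S = range (hull_val M d)"
  have sub: "S \<subseteq> universe M"
  proof -
    have "hull_val M d h \<in> universe M" for h
      by (cases h) (use d M in \<open>auto simp: is_struct_def intro: witness\<close>)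
    then show ?thesis by (auto simp: S_def)
  qed
  have const_in: "const_of M c \<in> S" for c
    using rangeI[of "hull_val M d" "HConst c"] by (simp add: S_def)
  have "d \<in> S" using rangeI[of "hull_val M d" Base] by (simp add: S_def)
  have "countable S" by (simp add: S_def)
  define f where "f = to_nat_on S"
  have inj: "inj_on f S" unfolding f_def using \<open>countable S\<close> by (rule inj_on_to_nat_on)
  define N where "N = \<lparr>universe = f ` S,
     rel_of = (\<lambda>R. map f ` {as \<in> rel_of M R. set as \<subseteq> S}), const_of = f \<circ> const_of M\<rparr>"
  have "length as = ar R" if "as \<in> rel_of M R" for as R
    using M that by (auto simp: is_struct_def)
  then have N: "is_struct ar N"
    using const_in \<open>d \<in> S\<close> by (auto simp: is_struct_def N_def subset_iff)
  have val: "val N (f \<circ> e) t = f (val M e t) \<and> val M e t \<in> S" if "range e \<subseteq> S" for e t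
    using that const_in by (cases t) (auto simp: N_def)
  have upd: "(f \<circ> e)(x := f a) = f \<circ> e(x := a)" for e x a by auto
  have transfer: "sat N (f \<circ> e) \<psi> \<longleftrightarrow> sat M e \<psi>" if "range e \<subseteq> S" for e \<psi>
    using that
  proof (induction \<psi> arbitrary: e)
    case (Rel R ts)
    have eq: "map (val N (f \<circ> e)) ts = map f (map (val M e) ts)"
      using val[OF Rel] by simp
    have in_S: "set (map (val M e) ts) \<subseteq> S" using val[OF Rel] by auto
    have map_inj: "map f as = map f bs \<Longrightarrow> set as \<subseteq> S \<Longrightarrow> set bs \<subseteq> S \<Longrightarrow> as = bs" for as bs
      using inj by (metis inj_on_subset map_inj_on Un_least)
    have "map f as \<in> rel_of N R \<longleftrightarrow> as \<in> rel_of M R" if "set as \<subseteq> S" for as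
      using that by (auto simp: N_def dest: map_inj)
    from this[OF in_S] show ?case unfolding sat.simps eq .
  next
    case (Eq s t)
    then show ?case unfolding sat.simps using val[OF Eq] inj by (metis inj_onD)
  next
    case (Exists x \<psi>)
    have env: "range (e(x := a)) \<subseteq> S" if "a \<in> S" for a using that Exists.prems by auto
    have "sat N (f \<circ> e) (Exists x \<psi>) \<longleftrightarrow> (\<exists>a\<in>S. sat N (f \<circ> e(x := a)) \<psi>)"
      by (simp add: N_def flip: upd)
    also have "\<dots> \<longleftrightarrow> (\<exists>a\<in>S. sat M (e(x := a)) \<psi>)" using Exists.IH env by blast
    also have "\<dots> \<longleftrightarrow> sat M e (Exists x \<psi>)"
      using hull_closed[OF d, of e x \<psi>, folded S_def] Exists.prems sub unfolding sat.simps by blast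
    finally show ?case .
  next
    case (Forall x \<psi>)
    have env: "range (e(x := a)) \<subseteq> S" if "a \<in> S" for a using that Forall.prems by auto
    have "sat N (f \<circ> e) (Forall x \<psi>) \<longleftrightarrow> (\<forall>a\<in>S. sat N (f \<circ> e(x := a)) \<psi>)"
      by (simp add: N_def flip: upd)
    also have "\<dots> \<longleftrightarrow> (\<forall>a\<in>S. sat M (e(x := a)) \<psi>)" using Forall.IH env by blast
    also have "\<dots> \<longleftrightarrow> sat M e (Forall x \<psi>)"
      using hull_closed[OF d, of e x "Neg \<psi>", folded S_def] Forall.prems sub unfolding sat.simps by blast
    finally show ?case .
  qed simp_all
  have "sat N e \<phi>" if "range e \<subseteq> universe N" for e
  proof -
    have "\<forall>x. \<exists>a\<in>S. e x = f a" using that by (auto simp: N_def)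
    then obtain e' where e': "\<And>x. e' x \<in> S" "\<And>x. e x = f (e' x)" by metis
    have "e = f \<circ> e'" using e' by auto
    moreover have "sat M e' \<phi>" using holds e'(1) sub by blast
    ultimately show ?thesis using transfer[of e' \<phi>] e'(1) by auto
  qed
  then show ?thesis using N by (auto simp: satisfiable_def is_model_def)
qed

end

theory Submission
  imports Defs "HOL-Probability.Product_PMF"
begin

text \<open>
  Following Gurevich and Shelah, a finite model is built at random from an arbitrary model \<open>A\<close>.
  For every set \<open>S\<close> of new elements a type over \<open>S\<close> (the truth values of all subformulas) is
  drawn, among those realised by maps from \<open>S\<close> to \<open>A\<close>. The set \<open>S\<close> is coherent if its type
  restricts to the types drawn for the subsets of \<open>S\<close>; only coherent sets carry atoms. As
  equality is absent, the maps need not be injective, so the type of a pair can always be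
  corrected to fit the types of its two points, and all pairs are coherent; guarded tuples are
  coherent because an atom holds on them. Hence no quantifier of a triguarded formula ever looks
  at an incoherent set. A witness in \<open>A\<close> for a coherent set \<open>S\<close> is copied to a new element \<open>b\<close> as
  soon as the types drawn for the sets \<open>T \<union> {b}\<close> with \<open>T \<subseteq> S\<close> are the right ones. These events are
  independent for different \<open>b\<close> and their probability is bounded below in terms of the number of
  types, so by a union bound doubly exponentially many elements suffice.
\<close>


section \<open>Random choices\<close>

lemma prob_Pi_pmf_eq_on:
  assumes "finite X" "D \<subseteq> X"
  shows "measure_pmf.prob (Pi_pmf X dflt p) {f. \<forall>x\<in>D. f x = g x} = (\<Prod>x\<in>D. pmf (p x) (g x))"
proof -
  define E where "E = (\<lambda>x. if x \<in> D then {g x} else UNIV)"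
  have "{f. \<forall>x\<in>D. f x = g x} = Pi X E"
    using assms(2) by (fastforce simp: E_def Pi_iff split: if_splits)
  then have "measure_pmf.prob (Pi_pmf X dflt p) {f. \<forall>x\<in>D. f x = g x} =
      (\<Prod>x\<in>X. measure_pmf.prob (p x) (E x))"
    using assms(1) by (simp add: measure_Pi_pmf_Pi)
  also have "\<dots> = (\<Prod>x\<in>D. measure_pmf.prob (p x) (E x))"
    using assms by (intro prod.mono_neutral_right) (auto simp: E_def)
  also have "\<dots> = (\<Prod>x\<in>D. pmf (p x) (g x))"
    by (intro prod.cong) (auto simp: E_def measure_pmf_single)
  finally show ?thesis .
qed

lemma prob_Pi_pmf_disagree_on_family:
  fixes D :: "'i \<Rightarrow> 'a set" and g :: "'i \<Rightarrow> 'a \<Rightarrow> 'b"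
  assumes "finite X" "finite I" and D: "\<And>i. i \<in> I \<Longrightarrow> D i \<subseteq> X" and disj: "disjoint_family_on D I"
  shows "measure_pmf.prob (Pi_pmf X dflt p) {f. \<forall>i\<in>I. \<exists>x\<in>D i. f x \<noteq> g i x} =
    (\<Prod>i\<in>I. 1 - (\<Prod>x\<in>D i. pmf (p x) (g i x)))"
proof (cases "I = {}")
  case False
  let ?p = "Pi_pmf X dflt p"
  let ?N = "\<lambda>i. PiM (D i) (\<lambda>_. count_space UNIV :: 'b measure)"
  define avoid where "avoid i = space (?N i) - {restrict (g i) (D i)}" for i
  have restr_eq: "restrict f (D i) = restrict (g i) (D i) \<longleftrightarrow> (\<forall>x\<in>D i. f x = g i x)" for f i
    by (metis restrict_apply' restrict_ext)
  have vimage: "(\<lambda>f. restrict f (D i)) -` avoid i = - {f. \<forall>x\<in>D i. f x = g i x}" for i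
    by (auto simp: avoid_def space_PiM restr_eq)
  have "avoid i \<in> sets (?N i)" if "i \<in> I" for i
  proof -
    have "finite (D i)" using D[OF that] \<open>finite X\<close> finite_subset by blast
    then have "PiE (D i) (\<lambda>x. {g i x}) \<in> sets (?N i)" by (intro sets_PiM_I_finite) auto
    then have "space (?N i) - PiE (D i) (\<lambda>x. {g i x}) \<in> sets (?N i)" by (rule sets.compl_sets)
    also have "PiE (D i) (\<lambda>x. {g i x}) = {restrict (g i) (D i)}"
      using PiE_singleton[of "restrict (g i) (D i)" "D i"] by (simp cong: PiE_cong)
    finally show ?thesis unfolding avoid_def .
  qed
  moreover have "prob_space.indep_vars ?p ?N (\<lambda>i f. restrict f (D i)) I"
    using prob_space.indep_vars_restrict[OF measure_pmf.prob_space_axioms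
        indep_vars_Pi_pmf[OF \<open>finite X\<close>] D disj] .
  ultimately have "measure_pmf.prob ?p (\<Inter>i\<in>I. (\<lambda>f. restrict f (D i)) -` avoid i) =
      (\<Prod>i\<in>I. measure_pmf.prob ?p ((\<lambda>f. restrict f (D i)) -` avoid i))"
    using prob_space.indep_varsD_finite[OF measure_pmf.prob_space_axioms, of ?p ?N _ I avoid] 
      False \<open>finite I\<close> by simp
  moreover have "measure_pmf.prob ?p (- {f. \<forall>x\<in>D i. f x = g i x}) =
      1 - (\<Prod>x\<in>D i. pmf (p x) (g i x))" if "i \<in> I" for i
    using prob_Pi_pmf_eq_on[OF \<open>finite X\<close> D[OF that]]
      measure_pmf.prob_compl[of "{f. \<forall>x\<in>D i. f x = g i x}" ?p]
    by (simp add: Compl_eq_Diff_UNIV)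
  moreover have "(\<Inter>i\<in>I. - {f. \<forall>x\<in>D i. f x = g i x}) = {f. \<forall>i\<in>I. \<exists>x\<in>D i. f x \<noteq> g i x}" by auto
  ultimately show ?thesis by (simp add: vimage)
qed simp

lemma prob_Pi_pmf_disagree_on_family_le:
  assumes "finite X" "finite I" "\<And>i. i \<in> I \<Longrightarrow> D i \<subseteq> X" "disjoint_family_on D I"
    and card: "\<And>i. i \<in> I \<Longrightarrow> card (D i) \<le> c"
    and pmf: "\<And>i x. i \<in> I \<Longrightarrow> x \<in> D i \<Longrightarrow> q \<le> pmf (p x) (g i x)" and q: "0 \<le> q" "q \<le> 1"
  shows "measure_pmf.prob (Pi_pmf X dflt p) {f. \<forall>i\<in>I. \<exists>x\<in>D i. f x \<noteq> g i x} \<le> (1 - q ^ c) ^ card I"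
proof -
  have "q ^ c \<le> (\<Prod>x\<in>D i. pmf (p x) (g i x))" if "i \<in> I" for i
  proof -
    have "q ^ c \<le> q ^ card (D i)" using q card[OF that] by (rule power_decreasing[rotated])
    also have "\<dots> = (\<Prod>x\<in>D i. q)" by simp
    also have "\<dots> \<le> (\<Prod>x\<in>D i. pmf (p x) (g i x))" using pmf[OF that] q by (intro prod_mono) auto
    finally show ?thesis .
  qed
  then have "(\<Prod>i\<in>I. 1 - (\<Prod>x\<in>D i. pmf (p x) (g i x))) \<le> (\<Prod>i\<in>I. 1 - q ^ c)"
    by (intro prod_mono) (auto intro!: prod_le_1 simp: pmf_le_1)
  then show ?thesis by (simp add: prob_Pi_pmf_disagree_on_family[OF assms(1-4)])
qed

lemma card_subsets_card_le:
  assumes "finite V"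
  shows "card {S. S \<subseteq> V \<and> card S \<le> k} \<le> (card V + 1) ^ k"
proof -
  define L where "L = {xs. set xs \<subseteq> insert None (Some ` V) \<and> length xs = k}"
  have "{S. S \<subseteq> V \<and> card S \<le> k} \<subseteq> (\<lambda>xs. Some -` set xs) ` L"
  proof clarify
    fix S assume S: "S \<subseteq> V" "card S \<le> k"
    then obtain xs where xs: "set xs = S" "distinct xs"
      using assms finite_distinct_list finite_subset by metis
    define ys where "ys = map Some xs @ replicate (k - card S) None"
    have "ys \<in> L" using S xs distinct_card[OF xs(2)] by (auto simp: ys_def L_def)
    moreover have "Some -` set ys = S" using xs by (auto simp: ys_def)
    ultimately show "S \<in> (\<lambda>xs. Some -` set xs) ` L" by blast
  qed
  moreover have "finite L" unfolding L_def using assms by (intro finite_lists_length_eq) auto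
  ultimately have "card {S. S \<subseteq> V \<and> card S \<le> k} \<le> card L" by (rule surj_card_le[rotated])
  also have "card L = (card V + 1) ^ k"
    using assms by (simp add: L_def card_lists_length_eq card_image)
  finally show ?thesis .
qed

lemma ex_set_pmf_union_bound:
  assumes "finite I" "(\<Sum>i\<in>I. measure_pmf.prob p (bad i)) < 1"
  obtains x where "x \<in> set_pmf p" "\<And>i. i \<in> I \<Longrightarrow> x \<notin> bad i"
proof -
  have "measure_pmf.prob p (\<Union>i\<in>I. bad i) < 1"
    using assms by (intro le_less_trans[OF measure_UNION_le]) auto
  then have "\<not> set_pmf p \<subseteq> (\<Union>i\<in>I. bad i)"
    using measure_pmf.prob_eq_1[of "\<Union>i\<in>I. bad i" p] by (auto simp: AE_measure_pmf_iff subset_iff)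
  then show thesis using that by auto
qed

lemma prob_Pi_pmf_no_extension_le:
  assumes "finite V" and S: "S \<subseteq> V" "card S \<le> k"
    and pmf: "\<And>b T. b \<in> V - S \<Longrightarrow> T \<subseteq> S \<Longrightarrow> q \<le> pmf (p (insert b T)) (g b (insert b T))"
    and q: "0 \<le> q" "q \<le> 1"
  shows "measure_pmf.prob (Pi_pmf (Pow V) dflt p)
      {f. \<forall>b\<in>V - S. \<exists>T\<in>insert b ` Pow S. f T \<noteq> g b T} \<le> (1 - q ^ 2 ^ k) ^ (card V - k)"
proof -
  have "finite S" using S \<open>finite V\<close> finite_subset by blast
  have "measure_pmf.prob (Pi_pmf (Pow V) dflt p)
      {f. \<forall>b\<in>V - S. \<exists>T\<in>insert b ` Pow S. f T \<noteq> g b T} \<le> (1 - q ^ 2 ^ k) ^ card (V - S)"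
  proof (rule prob_Pi_pmf_disagree_on_family_le)
    fix b
    have "card (insert b ` Pow S) \<le> 2 ^ card S"
      using card_image_le[of "Pow S" "insert b"] \<open>finite S\<close> by (simp add: card_Pow)
    also have "\<dots> \<le> 2 ^ k" using S by (intro power_increasing) auto
    finally show "card (insert b ` Pow S) \<le> 2 ^ k" .
  next
    show "disjoint_family_on (\<lambda>b. insert b ` Pow S) (V - S)"
      unfolding disjoint_family_on_def by auto
  qed (use \<open>finite V\<close> S pmf q in auto)
  also have "\<dots> \<le> (1 - q ^ 2 ^ k) ^ (card V - k)"
    using S \<open>finite S\<close> q by (intro power_decreasing) (auto simp: card_Diff_subset power_le_one)
  finally show ?thesis .
qed

lemma prob_uniform_no_extension_le:
  fixes g :: "'b \<Rightarrow> 'b set \<Rightarrow> 'c"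
  assumes "finite V" and S: "S \<subseteq> V" "card S \<le> k"
    and R: "\<And>T. T \<subseteq> V \<Longrightarrow> finite (R T) \<and> R T \<noteq> {}"
    and card_R: "\<And>T. T \<subseteq> V \<Longrightarrow> card T \<le> Suc k \<Longrightarrow> card (R T) \<le> M"
    and g: "\<And>b T. b \<in> V \<Longrightarrow> T \<subseteq> V \<Longrightarrow> g b T \<in> R T"
  shows "measure_pmf.prob (Pi_pmf (Pow V) dflt (\<lambda>T. pmf_of_set (R T)))
      {f. \<forall>b\<in>V - S. \<exists>T\<in>insert b ` Pow S. f T \<noteq> g b T} \<le> (1 - (1 / real M) ^ 2 ^ k) ^ (card V - k)"
proof (rule prob_Pi_pmf_no_extension_le[OF \<open>finite V\<close> S])
  fix b T assume b: "b \<in> V - S" and T: "T \<subseteq> S"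
  have "finite S" using S \<open>finite V\<close> finite_subset by blast
  then have "card T \<le> k" "finite T"
    using T S card_mono[of S T] finite_subset by auto
  then have "card (insert b T) \<le> Suc k" by (simp add: card_insert_if)
  moreover have bT: "insert b T \<subseteq> V" using b T S by auto
  moreover have "g b (insert b T) \<in> R (insert b T)" using g[OF _ bT] b by simp
  moreover have "0 < card (R (insert b T))" using R[OF bT] by (simp add: card_gt_0_iff)
  ultimately show "1 / real M \<le> pmf (pmf_of_set (R (insert b T))) (g b (insert b T))"
    using R[OF bT] card_R[OF bT] by (simp add: frac_le)
next
  show "1 / real M \<le> 1" by (cases M) auto
qed simp

lemma card_Sigma_small_subsets_le:
  assumes "finite V" and Q: "\<And>S. S \<subseteq> V \<Longrightarrow> card S \<le> k \<Longrightarrow> finite (Q S) \<and> card (Q S) \<le> P"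
  shows "card (SIGMA S:{S. S \<subseteq> V \<and> card S \<le> k}. Q S) \<le> P * (card V + 1) ^ k"
proof -
  let ?\<S> = "{S. S \<subseteq> V \<and> card S \<le> k}"
  have "finite ?\<S>" using \<open>finite V\<close> by simp
  then have "card (Sigma ?\<S> Q) = (\<Sum>S\<in>?\<S>. card (Q S))"
    using Q by (intro card_SigmaI) auto
  also have "\<dots> \<le> card ?\<S> * P"
    using sum_bounded_above[of ?\<S> "\<lambda>S. card (Q S)" P] Q by simp
  also have "\<dots> \<le> (card V + 1) ^ k * P"
    using card_subsets_card_le[OF \<open>finite V\<close>] by (intro mult_right_mono) auto
  finally show ?thesis by (simp add: mult.commute)
qed

lemma ex_extending_choice:
  fixes V :: "'b set" and R :: "'b set \<Rightarrow> 'c set" and Q :: "'b set \<Rightarrow> 'd set"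
  assumes "finite V"
    and R: "\<And>T. T \<subseteq> V \<Longrightarrow> finite (R T) \<and> R T \<noteq> {}"
    and card_R: "\<And>T. T \<subseteq> V \<Longrightarrow> card T \<le> Suc k \<Longrightarrow> card (R T) \<le> M"
    and Q: "\<And>S. S \<subseteq> V \<Longrightarrow> card S \<le> k \<Longrightarrow> finite (Q S) \<and> card (Q S) \<le> P"
    and g: "\<And>S q b T. S \<subseteq> V \<Longrightarrow> q \<in> Q S \<Longrightarrow> b \<in> V \<Longrightarrow> T \<subseteq> V \<Longrightarrow> g S q b T \<in> R T"
    and small: "real P * real (card V + 1) ^ k * (1 - (1 / real M) ^ 2 ^ k) ^ (card V - k) < 1"
  shows "\<exists>f. (\<forall>T\<subseteq>V. f T \<in> R T) \<and> (\<forall>S\<subseteq>V. card S \<le> k \<longrightarrow> (\<forall>q\<in>Q S.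
    \<exists>b\<in>V - S. \<forall>T\<subseteq>S. f (insert b T) = g S q b (insert b T)))"
proof -
  define p where "p = Pi_pmf (Pow V) undefined (\<lambda>T. pmf_of_set (R T))"
  define I where "I = (SIGMA S:{S. S \<subseteq> V \<and> card S \<le> k}. Q S)"
  define bad where "bad = (\<lambda>(S, q). {f. \<forall>b\<in>V - S. \<exists>T\<in>insert b ` Pow S. f T \<noteq> g S q b T})"
  define r where "r = (1 - (1 / real M) ^ 2 ^ k) ^ (card V - k)"
  have "finite I" using Q \<open>finite V\<close> by (auto simp: I_def)
  have card_I: "real (card I) \<le> real P * real (card V + 1) ^ k"
    using of_nat_mono[OF card_Sigma_small_subsets_le[OF \<open>finite V\<close> Q], where 'a = real]
    by (simp add: I_def)
  have prob_bad: "measure_pmf.prob p (bad (S, q)) \<le> r" if "S \<subseteq> V" "card S \<le> k" "q \<in> Q S" for S q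
    unfolding p_def bad_def prod.case r_def using that g
    by (intro prob_uniform_no_extension_le \<open>finite V\<close> R card_R)
  have "1 / real M \<le> 1" by (cases M) auto
  then have "0 \<le> r" by (auto simp: r_def power_le_one)
  have "(\<Sum>i\<in>I. measure_pmf.prob p (bad i)) \<le> real (card I) * r"
    using prob_bad by (intro sum_bounded_above) (auto simp: I_def)
  also have "\<dots> \<le> real P * real (card V + 1) ^ k * r"
    using card_I \<open>0 \<le> r\<close> by (rule mult_right_mono)
  also have "\<dots> < 1" unfolding r_def by (rule small)
  finally have "(\<Sum>i\<in>I. measure_pmf.prob p (bad i)) < 1" .
  then obtain f where f: "f \<in> set_pmf p" "\<And>i. i \<in> I \<Longrightarrow> f \<notin> bad i"
    using ex_set_pmf_union_bound[OF \<open>finite I\<close>] by metis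
  have "f T \<in> R T" if "T \<subseteq> V" for T
  proof -
    have "f T \<in> set_pmf (pmf_of_set (R T))"
      using f(1) that \<open>finite V\<close> by (auto simp: p_def set_Pi_pmf PiE_dflt_def)
    then show ?thesis using R[OF that] by simp
  qed
  moreover have "\<exists>b\<in>V - S. \<forall>T\<subseteq>S. f (insert b T) = g S q b (insert b T)"
    if "S \<subseteq> V" "card S \<le> k" "q \<in> Q S" for S q
    using f(2)[of "(S, q)"] that by (auto simp: I_def bad_def)
  ultimately show ?thesis by blast
qed


section \<open>Triguarded formulas\<close>

inductive guarded :: "fm \<Rightarrow> bool" where
  conj: "fv \<psi> \<subseteq> fv (Rel R ts) \<Longrightarrow> guarded (Conj (Rel R ts) \<psi>)"
| ex: "guarded \<theta> \<Longrightarrow> guarded (Exists x \<theta>)"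
| not_imp: "fv \<psi> \<subseteq> fv (Rel R ts) \<Longrightarrow> guarded (Neg (Imp (Rel R ts) \<psi>))"
| not_all: "guarded (Neg \<theta>) \<Longrightarrow> guarded (Neg (Forall x \<theta>))"

lemma sat_guarded:
  assumes "guarded \<theta>" "sat M e \<theta>"
  shows "\<exists>R ts e'. sat M e' (Rel R ts) \<and> fv \<theta> \<subseteq> fv (Rel R ts) \<and> (\<forall>x\<in>fv \<theta>. e' x = e x)"
  using assms
proof (induction arbitrary: e rule: guarded.induct)
  case (conj \<psi> R ts)
  then show ?case by (intro exI[of _ R] exI[of _ ts] exI[of _ e]) auto
next
  case (ex \<theta> x)
  then obtain a where "sat M (e(x := a)) \<theta>" by auto
  from ex.IH[OF this] obtain R ts e' where "sat M e' (Rel R ts)" "fv \<theta> \<subseteq> fv (Rel R ts)"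
    "\<forall>y\<in>fv \<theta>. e' y = (e(x := a)) y" by (auto simp del: sat.simps)
  then show ?case by (intro exI[of _ R] exI[of _ ts] exI[of _ e']) auto
next
  case (not_imp \<psi> R ts)
  then show ?case by (intro exI[of _ R] exI[of _ ts] exI[of _ e]) auto
next
  case (not_all \<theta> x)
  then obtain a where "sat M (e(x := a)) (Neg \<theta>)" by auto
  from not_all.IH[OF this] obtain R ts e' where "sat M e' (Rel R ts)" "fv \<theta> \<subseteq> fv (Rel R ts)"
    "\<forall>y\<in>fv \<theta>. e' y = (e(x := a)) y" by (auto simp del: sat.simps)
  then show ?case by (intro exI[of _ R] exI[of _ ts] exI[of _ e']) auto
qed

text \<open>
  A quantifier inside a guarded block is again guarded, so triguardedness can be checked one
  quantifier at a time.
\<close>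

fun triguarded :: "fm \<Rightarrow> bool" where
  "triguarded (Rel R ts) \<longleftrightarrow> True"
| "triguarded (Eq s t) \<longleftrightarrow> False"
| "triguarded (Neg \<phi>) \<longleftrightarrow> triguarded \<phi>"
| "triguarded (Conj \<phi> \<psi>) \<longleftrightarrow> triguarded \<phi> \<and> triguarded \<psi>"
| "triguarded (Disj \<phi> \<psi>) \<longleftrightarrow> triguarded \<phi> \<and> triguarded \<psi>"
| "triguarded (Imp \<phi> \<psi>) \<longleftrightarrow> triguarded \<phi> \<and> triguarded \<psi>"
| "triguarded (Iff \<phi> \<psi>) \<longleftrightarrow> triguarded \<phi> \<and> triguarded \<psi>"
| "triguarded (Exists x \<phi>) \<longleftrightarrow> triguarded \<phi> \<and> (guarded \<phi> \<or> card (fv \<phi>) \<le> 2)"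
| "triguarded (Forall x \<phi>) \<longleftrightarrow> triguarded \<phi> \<and> (guarded (Neg \<phi>) \<or> card (fv \<phi>) \<le> 2)"

lemma triguarded_foldr_Exists:
  "guarded \<theta> \<Longrightarrow> triguarded \<theta> \<Longrightarrow> guarded (foldr Exists xs \<theta>) \<and> triguarded (foldr Exists xs \<theta>)"
  by (induction xs) (auto intro: guarded.intros)

lemma triguarded_foldr_Forall:
  "guarded (Neg \<theta>) \<Longrightarrow> triguarded \<theta> \<Longrightarrow>
    guarded (Neg (foldr Forall xs \<theta>)) \<and> triguarded (foldr Forall xs \<theta>)"
  by (induction xs) (auto intro: guarded.intros)

lemma equality_free_foldr_Exists: "equality_free (foldr Exists xs \<theta>) \<longleftrightarrow> equality_free \<theta>"
  by (induction xs) auto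

lemma equality_free_foldr_Forall: "equality_free (foldr Forall xs \<theta>) \<longleftrightarrow> equality_free \<theta>"
  by (induction xs) auto

lemma card_le_2_if_subset_doubleton: "X \<subseteq> {x, y} \<Longrightarrow> card X \<le> 2"
  using card_mono[of "{x, y}" X] card_insert_le_m1[of 2 "{y}" x] by simp

lemma triguarded_if_TGF: "\<phi> \<in> TGF \<Longrightarrow> equality_free \<phi> \<Longrightarrow> triguarded \<phi>"
proof (induction rule: TGF.induct)
  case (atom \<phi>)
  then show ?case by (cases \<phi>) auto
next
  case (guarded_ex \<psi> \<gamma> xs)
  then obtain R ts where \<gamma>: "\<gamma> = Rel R ts"
    by (cases \<gamma>) (auto simp: equality_free_foldr_Exists)
  have "guarded (Conj \<gamma> \<psi>)" using \<open>set xs \<union> fv \<psi> \<subseteq> fv \<gamma>\<close> unfolding \<gamma> by (blast intro: guarded.conj)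
  moreover have "triguarded (Conj \<gamma> \<psi>)"
    using guarded_ex by (auto simp: \<gamma> equality_free_foldr_Exists)
  ultimately show ?case using triguarded_foldr_Exists by blast
next
  case (guarded_all \<psi> \<gamma> xs)
  then obtain R ts where \<gamma>: "\<gamma> = Rel R ts"
    by (cases \<gamma>) (auto simp: equality_free_foldr_Forall)
  have "guarded (Neg (Imp \<gamma> \<psi>))"
    using \<open>set xs \<union> fv \<psi> \<subseteq> fv \<gamma>\<close> unfolding \<gamma> by (blast intro: guarded.not_imp)
  moreover have "triguarded (Imp \<gamma> \<psi>)"
    using guarded_all by (auto simp: \<gamma> equality_free_foldr_Forall)
  ultimately show ?case using triguarded_foldr_Forall by blast
qed (auto simp: card_le_2_if_subset_doubleton)

fun subfms :: "fm \<Rightarrow> fm set" where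
  "subfms (Rel R ts) = {Rel R ts}"
| "subfms (Eq s t) = {Eq s t}"
| "subfms (Neg \<phi>) = insert (Neg \<phi>) (subfms \<phi>)"
| "subfms (Conj \<phi> \<psi>) = insert (Conj \<phi> \<psi>) (subfms \<phi> \<union> subfms \<psi>)"
| "subfms (Disj \<phi> \<psi>) = insert (Disj \<phi> \<psi>) (subfms \<phi> \<union> subfms \<psi>)"
| "subfms (Imp \<phi> \<psi>) = insert (Imp \<phi> \<psi>) (subfms \<phi> \<union> subfms \<psi>)"
| "subfms (Iff \<phi> \<psi>) = insert (Iff \<phi> \<psi>) (subfms \<phi> \<union> subfms \<psi>)"
| "subfms (Exists x \<phi>) = insert (Exists x \<phi>) (subfms \<phi>)"
| "subfms (Forall x \<phi>) = insert (Forall x \<phi>) (subfms \<phi>)"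

fun consts_trm :: "trm \<Rightarrow> nat set" where
  "consts_trm (Var x) = {}"
| "consts_trm (Const c) = {c}"

fun consts_fm :: "fm \<Rightarrow> nat set" where
  "consts_fm (Rel R ts) = (\<Union>t\<in>set ts. consts_trm t)"
| "consts_fm (Eq s t) = consts_trm s \<union> consts_trm t"
| "consts_fm (Neg \<phi>) = consts_fm \<phi>"
| "consts_fm (Conj \<phi> \<psi>) = consts_fm \<phi> \<union> consts_fm \<psi>"
| "consts_fm (Disj \<phi> \<psi>) = consts_fm \<phi> \<union> consts_fm \<psi>"
| "consts_fm (Imp \<phi> \<psi>) = consts_fm \<phi> \<union> consts_fm \<psi>"
| "consts_fm (Iff \<phi> \<psi>) = consts_fm \<phi> \<union> consts_fm \<psi>"
| "consts_fm (Exists x \<phi>) = consts_fm \<phi>"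
| "consts_fm (Forall x \<phi>) = consts_fm \<phi>"

lemma sat_Forall_iff: "sat M e (Forall x \<psi>) \<longleftrightarrow> \<not> sat M e (Exists x (Neg \<psi>))"
  by simp

lemma in_fv_Rel_iff: "x \<in> fv (Rel R ts) \<longleftrightarrow> Var x \<in> set ts"
proof -
  have "x \<in> vars_trm t \<longleftrightarrow> t = Var x" for t by (cases t) auto
  then show ?thesis by auto
qed

lemma subfms_refl: "\<phi> \<in> subfms \<phi>"
  by (cases \<phi>) auto

lemma finite_subfms: "finite (subfms \<phi>)"
  by (induction \<phi>) auto

lemma finite_consts_fm: "finite (consts_fm \<phi>)"
proof -
  have "finite (consts_trm t)" for t by (cases t) auto
  then show ?thesis by (induction \<phi>) auto
qed

lemma card_Un_le_add: "card A \<le> a \<Longrightarrow> card B \<le> b \<Longrightarrow> card (A \<union> B) \<le> a + b"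
  by (rule order_trans[OF card_Un_le]) simp

lemma card_insert_le_Suc: "card A \<le> a \<Longrightarrow> card (insert x A) \<le> Suc a"
  using card_insert_le_m1[of "Suc a" A x] by simp

lemma card_UN_set_le_length:
  assumes "\<And>t. card (f t) \<le> 1"
  shows "card (\<Union>t\<in>set ts. f t) \<le> length ts"
proof -
  have "card (\<Union>t\<in>set ts. f t) \<le> (\<Sum>t\<in>set ts. card (f t))" by (rule card_UN_le) simp
  also have "\<dots> \<le> card (set ts)"
    using sum_bounded_above[of "set ts" "\<lambda>t. card (f t)" 1] assms by simp
  also have "\<dots> \<le> length ts" by (rule card_length)
  finally show ?thesis .
qed

lemma card_subfms_le: "card (subfms \<phi>) \<le> fm_length \<phi>"
  by (induction \<phi>) (auto intro: order_trans[OF card_insert_le_Suc[OF card_Un_le_add]]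
      order_trans[OF card_insert_le_Suc])

lemma card_fv_le: "card (fv \<phi>) \<le> fm_length \<phi>"
proof (induction \<phi>)
  case (Rel R ts)
  have "card (vars_trm t) \<le> 1" for t by (cases t) auto
  then have "card (fv (Rel R ts)) \<le> length ts" unfolding fv.simps by (rule card_UN_set_le_length)
  then show ?case by simp
next
  case (Eq s t)
  show ?case by (cases s; cases t) (simp_all add: card_insert_if)
next
  case (Exists x \<phi>)
  then show ?case using card_Diff1_le[of "fv \<phi>" x] by simp
next
  case (Forall x \<phi>)
  then show ?case using card_Diff1_le[of "fv \<phi>" x] by simp
qed (auto intro: order_trans[OF card_Un_le_add])

lemma card_consts_fm_le: "card (consts_fm \<phi>) \<le> fm_length \<phi>"
proof (induction \<phi>)
  case (Rel R ts)
  have "card (consts_trm t) \<le> 1" for t by (cases t) auto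
  then have "card (consts_fm (Rel R ts)) \<le> length ts"
    unfolding consts_fm.simps by (rule card_UN_set_le_length)
  then show ?case by simp
next
  case (Eq s t)
  show ?case by (cases s; cases t) (simp_all add: card_insert_if)
qed (auto intro: order_trans[OF card_Un_le_add])

lemma fm_length_subfms_le: "\<psi> \<in> subfms \<phi> \<Longrightarrow> fm_length \<psi> \<le> fm_length \<phi>"
  by (induction \<phi>) auto

lemma fm_length_ge_3: "3 \<le> fm_length \<phi>"
  by (induction \<phi>) auto


section \<open>Types\<close>

definition fm_type :: "'a struct \<Rightarrow> fm set \<Rightarrow> 'i set \<Rightarrow> ('i \<Rightarrow> 'a) \<Rightarrow> (fm \<times> (var \<Rightarrow> 'i)) set" where
  "fm_type A F I h = {(\<psi>, \<sigma>). \<psi> \<in> F \<and> \<sigma> \<in> fv \<psi> \<rightarrow>\<^sub>E I \<and> sat A (h \<circ> \<sigma>) \<psi>}"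

lemma fm_type_eq_iff:
  "fm_type A F I h = fm_type A F I h' \<longleftrightarrow>
    (\<forall>\<psi>\<in>F. \<forall>e. e ` fv \<psi> \<subseteq> I \<longrightarrow> (sat A (h \<circ> e) \<psi> \<longleftrightarrow> sat A (h' \<circ> e) \<psi>))"
proof
  assume eq: "fm_type A F I h = fm_type A F I h'"
  show "\<forall>\<psi>\<in>F. \<forall>e. e ` fv \<psi> \<subseteq> I \<longrightarrow> (sat A (h \<circ> e) \<psi> \<longleftrightarrow> sat A (h' \<circ> e) \<psi>)"
  proof (intro ballI allI impI)
    fix \<psi> e assume "\<psi> \<in> F" "e ` fv \<psi> \<subseteq> I"
    then have "sat A (g \<circ> e) \<psi> \<longleftrightarrow> (\<psi>, restrict e (fv \<psi>)) \<in> fm_type A F I g" for g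
      using sat_cong[of \<psi> "g \<circ> e" "g \<circ> restrict e (fv \<psi>)"] by (auto simp: fm_type_def)
    then show "sat A (h \<circ> e) \<psi> \<longleftrightarrow> sat A (h' \<circ> e) \<psi>" using eq by simp
  qed
next
  assume "\<forall>\<psi>\<in>F. \<forall>e. e ` fv \<psi> \<subseteq> I \<longrightarrow> (sat A (h \<circ> e) \<psi> \<longleftrightarrow> sat A (h' \<circ> e) \<psi>)"
  then show "fm_type A F I h = fm_type A F I h'"
    unfolding fm_type_def by (intro Collect_cong) (auto simp: PiE_iff image_subset_iff)
qed

lemma fm_type_eq_reindex:
  assumes eq: "fm_type A F I h = fm_type A F I h'" and \<rho>: "\<rho> ` J \<subseteq> I"
    and h: "\<And>j. j \<in> J \<Longrightarrow> g j = h (\<rho> j)" and h': "\<And>j. j \<in> J \<Longrightarrow> g' j = h' (\<rho> j)"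
  shows "fm_type A F J g = fm_type A F J g'"
  unfolding fm_type_eq_iff
proof (intro ballI allI impI)
  fix \<psi> e assume \<psi>: "\<psi> \<in> F" and e: "e ` fv \<psi> \<subseteq> J"
  have "sat A (g \<circ> e) \<psi> \<longleftrightarrow> sat A (h \<circ> (\<rho> \<circ> e)) \<psi>" using e h by (intro sat_cong) auto
  also have "\<dots> \<longleftrightarrow> sat A (h' \<circ> (\<rho> \<circ> e)) \<psi>"
  proof -
    have "(\<rho> \<circ> e) ` fv \<psi> \<subseteq> I" using e \<rho> by auto
    then show ?thesis using eq \<psi> unfolding fm_type_eq_iff by blast
  qed
  also have "\<dots> \<longleftrightarrow> sat A (g' \<circ> e) \<psi>" using e h' by (intro sat_cong) auto
  finally show "sat A (g \<circ> e) \<psi> \<longleftrightarrow> sat A (g' \<circ> e) \<psi>" .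
qed

lemma finite_fm_types:
  assumes "finite F" "finite I"
  shows "finite (fm_type A F I ` H)"
proof -
  have "finite (SIGMA \<psi>:F. fv \<psi> \<rightarrow>\<^sub>E I)" using assms finite_fv by (auto intro: finite_PiE)
  then have "finite (Pow (SIGMA \<psi>:F. fv \<psi> \<rightarrow>\<^sub>E I))" by simp
  then show ?thesis by (rule finite_subset[rotated]) (auto simp: fm_type_def)
qed

lemma card_fm_types_le:
  assumes "finite F" "finite I" and card_fv: "\<And>\<psi>. \<psi> \<in> F \<Longrightarrow> card (fv \<psi>) \<le> k"
    and m: "card I \<le> m" "0 < m"
  shows "card (fm_type A F I ` H) \<le> 2 ^ (card F * m ^ k)"
proof -
  define Z where "Z = (SIGMA \<psi>:F. fv \<psi> \<rightarrow>\<^sub>E I)"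
  have fin: "finite (fv \<psi> \<rightarrow>\<^sub>E I)" for \<psi> using \<open>finite I\<close> finite_fv by (auto intro: finite_PiE)
  then have "finite Z" using \<open>finite F\<close> by (auto simp: Z_def)
  have "card (fv \<psi> \<rightarrow>\<^sub>E I) \<le> m ^ k" if "\<psi> \<in> F" for \<psi>
  proof -
    have "card (fv \<psi> \<rightarrow>\<^sub>E I) = card I ^ card (fv \<psi>)" using finite_fv by (simp add: card_PiE)
    also have "\<dots> \<le> m ^ card (fv \<psi>)" using m(1) by (rule power_mono) simp
    also have "\<dots> \<le> m ^ k" using card_fv[OF that] m(2) by (intro power_increasing) auto
    finally show ?thesis .
  qed
  then have "card Z \<le> card F * m ^ k"
    using \<open>finite F\<close> fin sum_bounded_above[of F "\<lambda>\<psi>. card (fv \<psi> \<rightarrow>\<^sub>E I)" "m ^ k"]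
    by (simp add: Z_def card_SigmaI)
  then have "card (Pow Z) \<le> 2 ^ (card F * m ^ k)"
    using \<open>finite Z\<close> by (simp add: card_Pow power_increasing)
  moreover have "fm_type A F I ` H \<subseteq> Pow Z" by (auto simp: fm_type_def Z_def)
  then have "card (fm_type A F I ` H) \<le> card (Pow Z)" using \<open>finite Z\<close> by (intro card_mono) auto
  ultimately show ?thesis by linarith
qed


section \<open>Placements of new elements\<close>

text \<open>
  Besides the elements of \<open>V\<close>, the new model has an element \<open>cst c\<close> for every \<open>c \<in> C\<close>; a placement
  maps it to the value of \<open>c\<close> in \<open>A\<close>.
\<close>

locale placement_space =
  fixes ar :: "nat \<Rightarrow> nat" and A :: "'a struct" and F :: "fm set" and C :: "nat set"
    and V :: "'b set" and cst :: "nat \<Rightarrow> 'b"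
  assumes struct_A: "is_struct ar A" and finite_F: "finite F" and finite_C: "finite C"
    and finite_V: "finite V" and inj_cst: "inj cst" and cst_notin_V: "cst c \<notin> V"
begin

abbreviation K :: "'b set" where "K \<equiv> cst ` C"

definition placements :: "('b \<Rightarrow> 'a) set" where
  "placements = {h. range h \<subseteq> universe A \<and> (\<forall>c. h (cst c) = const_of A c)}"

definition type_over :: "'b set \<Rightarrow> ('b \<Rightarrow> 'a) \<Rightarrow> (fm \<times> (var \<Rightarrow> 'b)) set" where
  "type_over S = fm_type A F (S \<union> K)"

definition extension_property :: "nat \<Rightarrow> ('b set \<Rightarrow> 'b \<Rightarrow> 'a) \<Rightarrow> bool" where
  "extension_property k d \<longleftrightarrow>
     (\<forall>T\<subseteq>V. d T \<in> placements) \<and>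
     (\<forall>S\<subseteq>V. card S \<le> k \<longrightarrow> (\<forall>h\<in>placements. \<forall>a\<in>universe A. \<exists>b\<in>V - S. \<forall>T\<subseteq>S.
        type_over (insert b T) (d (insert b T)) = type_over (insert b T) (h(b := a))))"

text \<open>
  The additional point \<open>a\<close> is represented by \<open>None\<close>, so that the type does not depend on the
  element of \<open>V\<close> that will be placed at \<open>a\<close>.
\<close>

definition pointed_type ::
    "'b set \<Rightarrow> ('b \<Rightarrow> 'a) \<times> 'a \<Rightarrow> (fm \<times> (var \<Rightarrow> 'b option)) set" where
  "pointed_type S = (\<lambda>(h, a). fm_type A F (insert None (Some ` (S \<union> K))) (case_option a h))"

lemma placement_in_universe: "h \<in> placements \<Longrightarrow> h i \<in> universe A"
  by (auto simp: placements_def)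

lemma placement_cst: "h \<in> placements \<Longrightarrow> h (cst c) = const_of A c"
  by (simp add: placements_def)

lemma placements_nonempty: "placements \<noteq> {}"
proof -
  have "(\<lambda>i. const_of A (inv cst i)) \<in> placements"
    using struct_A inj_cst by (auto simp: placements_def is_struct_def)
  then show ?thesis by blast
qed

lemma placement_upd:
  assumes "h \<in> placements" "a \<in> universe A" "b \<in> V"
  shows "h(b := a) \<in> placements"
proof -
  have "cst c \<noteq> b" for c using assms(3) cst_notin_V by blast
  then show ?thesis using assms(1,2) by (auto simp: placements_def)
qed

lemma type_over_mono: "type_over S h = type_over S h' \<Longrightarrow> T \<subseteq> S \<Longrightarrow> type_over T h = type_over T h'"
  unfolding type_over_def by (erule fm_type_eq_reindex[where \<rho> = "\<lambda>i. i"]) auto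

lemma type_over_cong:
  assumes "h \<in> placements" "h' \<in> placements" "\<And>i. i \<in> S \<Longrightarrow> h i = h' i"
  shows "type_over S h = type_over S h'"
  unfolding type_over_def
  using assms
  by (intro fm_type_eq_reindex[where \<rho> = "\<lambda>i. i", OF refl[of "fm_type A F (S \<union> K) h"]])
    (auto simp: placement_cst)

lemma pointed_type_eqD:
  assumes eq: "pointed_type S (h, a) = pointed_type S (h', a')" and T: "T \<subseteq> S"
  shows "type_over (insert b T) (h(b := a)) = type_over (insert b T) (h'(b := a'))"
  unfolding type_over_def
proof (rule fm_type_eq_reindex)
  show "fm_type A F (insert None (Some ` (S \<union> K))) (case_option a h) =
      fm_type A F (insert None (Some ` (S \<union> K))) (case_option a' h')"
    using eq by (simp add: pointed_type_def)
  show "(\<lambda>i. if i = b then None else Some i) ` (insert b T \<union> K) \<subseteq> insert None (Some ` (S \<union> K))"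
    using T by auto
qed auto

lemma pointed_type_image:
  "pointed_type S ` U =
    fm_type A F (insert None (Some ` (S \<union> K))) ` (\<lambda>(h, a). case_option a h) ` U"
  by (simp add: pointed_type_def image_image case_prod_beta')

lemma finite_Un_K: "S \<subseteq> V \<Longrightarrow> finite (S \<union> K)"
  using finite_subset[OF _ finite_V] finite_C by blast

lemma card_Un_K_le: "card (S \<union> K) \<le> card S + card C"
  using card_Un_le[of S K] card_image_le[OF finite_C, of cst] by linarith

lemma finite_types_over: "S \<subseteq> V \<Longrightarrow> finite (type_over S ` H)"
  unfolding type_over_def by (intro finite_fm_types finite_F finite_Un_K)

lemma finite_pointed_types: "S \<subseteq> V \<Longrightarrow> finite (pointed_type S ` U)"
  unfolding pointed_type_image
  by (intro finite_fm_types finite_F finite.insertI finite_imageI finite_Un_K)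

lemma card_types_over_le:
  assumes "\<And>\<psi>. \<psi> \<in> F \<Longrightarrow> card (fv \<psi>) \<le> k" "S \<subseteq> V" "card S + card C \<le> m" "0 < m"
  shows "card (type_over S ` H) \<le> 2 ^ (card F * m ^ k)"
proof -
  have "card (S \<union> K) \<le> m" using card_Un_K_le[of S] assms(3) by linarith
  then show ?thesis
    unfolding type_over_def using assms by (intro card_fm_types_le finite_F finite_Un_K)
qed

lemma card_pointed_types_le:
  assumes "\<And>\<psi>. \<psi> \<in> F \<Longrightarrow> card (fv \<psi>) \<le> k" "S \<subseteq> V" "card S + card C < m"
  shows "card (pointed_type S ` U) \<le> 2 ^ (card F * m ^ k)"
proof -
  let ?I = "insert None (Some ` (S \<union> K))"
  have "card ?I \<le> m" "finite ?I"
    using card_Un_K_le[of S] finite_Un_K[OF assms(2)] assms(3)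
    by (simp_all add: card_image card_insert_if)
  then show ?thesis
    unfolding pointed_type_image using assms(1,3) finite_F by (intro card_fm_types_le) auto
qed

definition extension_type ::
    "'b set \<Rightarrow> (fm \<times> (var \<Rightarrow> 'b option)) set \<Rightarrow> 'b \<Rightarrow> 'b set \<Rightarrow> (fm \<times> (var \<Rightarrow> 'b)) set" where
  "extension_type S q b T =
     (case inv_into (placements \<times> universe A) (pointed_type S) q of
        (h, a) \<Rightarrow> type_over T (h(b := a)))"

lemma extension_type_realized:
  assumes "q \<in> pointed_type S ` (placements \<times> universe A)" "b \<in> V"
  shows "extension_type S q b T \<in> type_over T ` placements"
  using inv_into_into[OF assms(1)] assms(2) placement_upd
  by (auto simp: extension_type_def split: prod.splits)

lemma extension_type_pointed_type:
  assumes "h \<in> placements" "a \<in> universe A" "T \<subseteq> S"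
  shows "extension_type S (pointed_type S (h, a)) b (insert b T) =
    type_over (insert b T) (h(b := a))"
proof -
  obtain h' a' where eq:
    "inv_into (placements \<times> universe A) (pointed_type S) (pointed_type S (h, a)) = (h', a')"
    by (cases "inv_into (placements \<times> universe A) (pointed_type S) (pointed_type S (h, a))")
  have "pointed_type S (h, a) \<in> pointed_type S ` (placements \<times> universe A)"
    using assms(1,2) by (intro imageI) simp
  from f_inv_into_f[OF this] have "pointed_type S (h', a') = pointed_type S (h, a)"
    by (simp add: eq)
  from pointed_type_eqD[OF this assms(3)] show ?thesis by (simp add: extension_type_def eq)
qed

lemma ex_type_choice:
  assumes card_fv: "\<And>\<psi>. \<psi> \<in> F \<Longrightarrow> card (fv \<psi>) \<le> k"
    and M: "2 ^ (card F * (k + card C + 1) ^ k) \<le> M"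
    and small: "real M * real (card V + 1) ^ k * (1 - (1 / real M) ^ 2 ^ k) ^ (card V - k) < 1"
  obtains \<tau> where "\<And>T. T \<subseteq> V \<Longrightarrow> \<tau> T \<in> type_over T ` placements"
    and "\<And>S h a. S \<subseteq> V \<Longrightarrow> card S \<le> k \<Longrightarrow> h \<in> placements \<Longrightarrow> a \<in> universe A \<Longrightarrow>
      \<exists>b\<in>V - S. \<forall>T\<subseteq>S. \<tau> (insert b T) = type_over (insert b T) (h(b := a))"
proof -
  let ?U = "placements \<times> universe A"
  have types: "finite (type_over T ` placements) \<and> type_over T ` placements \<noteq> {}"
    if "T \<subseteq> V" for T
    using that finite_types_over placements_nonempty by simp
  have card_types: "card (type_over T ` placements) \<le> M" if "T \<subseteq> V" "card T \<le> Suc k" for T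
    using card_types_over_le[OF card_fv, of T "k + card C + 1" placements] M that by simp
  have pointed_types: "finite (pointed_type S ` ?U) \<and> card (pointed_type S ` ?U) \<le> M"
    if "S \<subseteq> V" "card S \<le> k" for S
    using card_pointed_types_le[OF card_fv, of S "k + card C + 1" ?U] M that finite_pointed_types
    by simp
  obtain \<tau> where \<tau>: "\<forall>T\<subseteq>V. \<tau> T \<in> type_over T ` placements"
    and extending: "\<forall>S\<subseteq>V. card S \<le> k \<longrightarrow> (\<forall>q\<in>pointed_type S ` ?U.
      \<exists>b\<in>V - S. \<forall>T\<subseteq>S. \<tau> (insert b T) = extension_type S q b (insert b T))"
    using ex_extending_choice[where R = "\<lambda>T. type_over T ` placements" and
        Q = "\<lambda>S. pointed_type S ` ?U" and g = extension_type,
        OF finite_V types card_types pointed_types extension_type_realized small] by blast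
  have "\<exists>b\<in>V - S. \<forall>T\<subseteq>S. \<tau> (insert b T) = type_over (insert b T) (h(b := a))"
    if S: "S \<subseteq> V" "card S \<le> k" and h: "h \<in> placements" "a \<in> universe A" for S h a
  proof -
    have "pointed_type S (h, a) \<in> pointed_type S ` ?U" using h by auto
    then obtain b where "b \<in> V - S"
      "\<forall>T\<subseteq>S. \<tau> (insert b T) = extension_type S (pointed_type S (h, a)) b (insert b T)"
      using extending S by blast
    then show ?thesis using extension_type_pointed_type[OF h] by auto
  qed
  then show thesis using that[of \<tau>] \<tau> by simp
qed

lemma ex_extension_property:
  assumes "\<And>\<psi>. \<psi> \<in> F \<Longrightarrow> card (fv \<psi>) \<le> k" "2 ^ (card F * (k + card C + 1) ^ k) \<le> M"
    and "real M * real (card V + 1) ^ k * (1 - (1 / real M) ^ 2 ^ k) ^ (card V - k) < 1"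
  shows "\<exists>d. extension_property k d"
proof -
  obtain \<tau> where \<tau>: "\<And>T. T \<subseteq> V \<Longrightarrow> \<tau> T \<in> type_over T ` placements"
    and ext: "\<And>S h a. S \<subseteq> V \<Longrightarrow> card S \<le> k \<Longrightarrow> h \<in> placements \<Longrightarrow> a \<in> universe A \<Longrightarrow>
      \<exists>b\<in>V - S. \<forall>T\<subseteq>S. \<tau> (insert b T) = type_over (insert b T) (h(b := a))"
    using ex_type_choice[OF assms] by metis
  define d where "d T = inv_into placements (type_over T) (\<tau> T)" for T
  have d: "d T \<in> placements" "type_over T (d T) = \<tau> T" if "T \<subseteq> V" for T
    using \<tau>[OF that] by (auto simp: d_def inv_into_into f_inv_into_f)
  have "\<exists>b\<in>V - S. \<forall>T\<subseteq>S.
      type_over (insert b T) (d (insert b T)) = type_over (insert b T) (h(b := a))"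
    if S: "S \<subseteq> V" "card S \<le> k" and h: "h \<in> placements" "a \<in> universe A" for S h a
  proof -
    obtain b where b: "b \<in> V - S"
      "\<forall>T\<subseteq>S. \<tau> (insert b T) = type_over (insert b T) (h(b := a))"
      using ext[OF S h] by blast
    moreover have "insert b T \<subseteq> V" if "T \<subseteq> S" for T using that S(1) b(1) by auto
    ultimately show ?thesis using d(2) by auto
  qed
  with d(1) have "extension_property k d" by (simp add: extension_property_def)
  then show ?thesis by blast
qed

end


section \<open>The finite model\<close>

locale proposals = placement_space ar A F C V cst
  for ar :: "nat \<Rightarrow> nat" and A :: "'a struct" and F :: "fm set" and C :: "nat set"
    and V :: "'b set" and cst :: "nat \<Rightarrow> 'b" +
  fixes k :: nat and d :: "'b set \<Rightarrow> 'b \<Rightarrow> 'a"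
  assumes extension_property: "extension_property k d"
begin

text \<open>
  A proposal that contradicts the types of single points is replaced by a map gluing these
  points together. This is what makes every pair coherent.
\<close>

definition chart :: "'b set \<Rightarrow> 'b \<Rightarrow> 'a" where
  "chart S =
     (if \<forall>i\<in>S. type_over {i} (d S) = type_over {i} (d {i}) then d S
      else (\<lambda>i. if i \<in> V then d {i} i else d {} i))"

definition coherent :: "'b set \<Rightarrow> bool" where
  "coherent S \<longleftrightarrow> S \<subseteq> V \<and> (\<forall>T\<subseteq>S. type_over T (chart S) = type_over T (chart T))"

lemma proposal_placement: "T \<subseteq> V \<Longrightarrow> d T \<in> placements"
  using extension_property by (simp add: extension_property_def)

lemma ex_proposal_extension:
  assumes "S \<subseteq> V" "card S \<le> k" "h \<in> placements" "a \<in> universe A"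
  obtains b where "b \<in> V - S"
    and "\<And>T. T \<subseteq> S \<Longrightarrow> type_over (insert b T) (d (insert b T)) = type_over (insert b T) (h(b := a))"
  using extension_property assms unfolding extension_property_def by meson

lemma V_nonempty: "V \<noteq> {}"
proof -
  obtain h a where "h \<in> placements" "a \<in> universe A"
    using placements_nonempty placement_in_universe by blast
  from ex_proposal_extension[OF _ _ this, of "{}"] show ?thesis by auto
qed

lemma chart_placement:
  assumes "S \<subseteq> V"
  shows "chart S \<in> placements"
proof -
  have "(\<lambda>i. if i \<in> V then d {i} i else d {} i) \<in> placements"
    using proposal_placement[of "{}"] proposal_placement cst_notin_V
    by (auto simp: placements_def intro: placement_in_universe)
  then show ?thesis using proposal_placement[OF assms] by (simp add: chart_def)
qed

lemma type_over_singleton_chart: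
  assumes "i \<in> S" "S \<subseteq> V"
  shows "type_over {i} (chart S) = type_over {i} (chart {i})"
proof (cases "\<forall>j\<in>S. type_over {j} (d S) = type_over {j} (d {j})")
  case True
  then show ?thesis using assms(1) by (simp add: chart_def)
next
  case False
  then have "chart S i = chart {i} i" using assms by (auto simp: chart_def)
  then show ?thesis using assms chart_placement by (intro type_over_cong) auto
qed

lemma coherent_subset:
  assumes "coherent S" "T \<subseteq> S"
  shows "coherent T"
  unfolding coherent_def
proof (intro conjI allI impI)
  show "T \<subseteq> V" using assms by (auto simp: coherent_def)
  fix T' assume "T' \<subseteq> T"
  then have "type_over T' (chart T) = type_over T' (chart S)"
    using assms type_over_mono[of T "chart S" "chart T" T'] by (simp add: coherent_def)
  also have "\<dots> = type_over T' (chart T')" using assms \<open>T' \<subseteq> T\<close> by (simp add: coherent_def)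
  finally show "type_over T' (chart T) = type_over T' (chart T')" .
qed

lemma coherent_if_card_le_2:
  assumes "S \<subseteq> V" "card S \<le> 2"
  shows "coherent S"
  unfolding coherent_def
proof (intro conjI allI impI)
  fix T assume T: "T \<subseteq> S"
  have "finite S" using assms(1) finite_V finite_subset by blast
  consider (eq) "T = S" | (empty) "T = {}" | (singleton) i where "T = {i}"
  proof (cases "T = S")
    case False
    then have "card T < card S" using T \<open>finite S\<close> by (simp add: psubset_card_mono)
    then have "card T = 0 \<or> card T = 1" using assms(2) by linarith
    moreover have "finite T" using T \<open>finite S\<close> by (rule finite_subset)
    ultimately show thesis using that by (metis card_0_eq card_1_singletonE)
  qed (rule that)
  then show "type_over T (chart S) = type_over T (chart T)"
  proof cases
    case empty
    then show ?thesis using assms(1) chart_placement by (intro type_over_cong) auto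
  next
    case singleton
    then show ?thesis using type_over_singleton_chart T assms(1) by simp
  qed simp
qed (rule assms)

lemma type_over_chart_insert:
  assumes old: "\<And>i. i \<in> S \<Longrightarrow> type_over {i} (d {i}) = type_over {i} h"
    and new: "\<And>T. T \<subseteq> S \<Longrightarrow> type_over (insert b T) (d (insert b T)) = type_over (insert b T) h"
    and T: "T \<subseteq> S"
  shows "type_over (insert b T) (chart (insert b T)) = type_over (insert b T) h"
proof -
  have "type_over {i} (d (insert b T)) = type_over {i} (d {i})" if i: "i \<in> insert b T" for i
  proof -
    have "type_over {i} (d (insert b T)) = type_over {i} h"
      using type_over_mono[OF new[OF T]] i by simp
    also have "\<dots> = type_over {i} (d {i})" using old[of i] new[of "{}"] i T by auto
    finally show ?thesis .
  qed
  then have "chart (insert b T) = d (insert b T)" by (simp add: chart_def)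
  then show ?thesis using new[OF T] by simp
qed

lemma coherent_extension:
  assumes S: "coherent S" "card S \<le> k" and a: "a \<in> universe A"
  obtains b where "b \<in> V - S" "coherent (insert b S)"
    "type_over (insert b S) (chart (insert b S)) = type_over (insert b S) ((chart S)(b := a))"
proof -
  have "S \<subseteq> V" using S(1) by (simp add: coherent_def)
  then obtain b where b: "b \<in> V - S" and new: "\<And>T. T \<subseteq> S \<Longrightarrow>
      type_over (insert b T) (d (insert b T)) = type_over (insert b T) ((chart S)(b := a))"
    using ex_proposal_extension[OF _ S(2) chart_placement a] by metis
  define h where "h = (chart S)(b := a)"
  have old: "type_over T (chart T) = type_over T h" if "T \<subseteq> S" for T
  proof -
    have "h \<in> placements" using placement_upd chart_placement \<open>S \<subseteq> V\<close> a b by (simp add: h_def)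
    have "type_over T (chart T) = type_over T (chart S)" using S(1) that by (simp add: coherent_def)
    also have "\<dots> = type_over T h"
      using that b chart_placement[OF \<open>S \<subseteq> V\<close>] \<open>h \<in> placements\<close>
      by (intro type_over_cong) (auto simp: h_def)
    finally show ?thesis .
  qed
  have insert_b: "type_over (insert b T) (chart (insert b T)) = type_over (insert b T) h"
    if "T \<subseteq> S" for T
    using that old[of "{_}"] new
    by (intro type_over_chart_insert[of S]) (auto simp: chart_def h_def)
  have "type_over T (chart T) = type_over T h" if "T \<subseteq> insert b S" for T
  proof (cases "b \<in> T")
    case True
    then show ?thesis using insert_b[of "T - {b}"] that
      by (simp add: insert_absorb subset_insert_iff)
  next
    case False
    then show ?thesis using old that by (simp add: subset_insert)
  qed
  then have "coherent (insert b S)"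
    using type_over_mono[OF insert_b[OF order_refl]] b \<open>S \<subseteq> V\<close> by (simp add: coherent_def)
  then show thesis using that b insert_b[OF order_refl] by (simp add: h_def)
qed

definition charted_model :: "'b struct" where
  "charted_model = \<lparr>universe = V \<union> K,
     rel_of = (\<lambda>R. {bs. set bs \<subseteq> V \<union> K \<and> coherent (set bs \<inter> V) \<and>
       map (chart (set bs \<inter> V)) bs \<in> rel_of A R}),
     const_of = (\<lambda>c. if c \<in> C then cst c else (SOME v. v \<in> V))\<rparr>"

lemma universe_charted_model: "universe charted_model = V \<union> K"
  by (simp add: charted_model_def)

lemma const_of_charted_model: "c \<in> C \<Longrightarrow> const_of charted_model c = cst c"
  by (simp add: charted_model_def)

lemma is_struct_charted_model: "is_struct ar charted_model"
proof -
  have "length bs = ar R" if "map h bs \<in> rel_of A R" for h :: "'b \<Rightarrow> 'a" and bs R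
    using struct_A that unfolding is_struct_def
    by (metis (mono_tags) length_map mem_Collect_eq subsetD)
  then show ?thesis using V_nonempty
    by (auto simp: is_struct_def charted_model_def some_in_eq)
qed

lemma sat_charted_model_Rel:
  "sat charted_model e (Rel R ts) \<longleftrightarrow>
     (let bs = map (val charted_model e) ts in
      set bs \<subseteq> V \<union> K \<and> coherent (set bs \<inter> V) \<and> map (chart (set bs \<inter> V)) bs \<in> rel_of A R)"
  by (simp add: charted_model_def Let_def)

lemma fv_Rel_image_subset: "e ` fv (Rel R ts) \<subseteq> set (map (val charted_model e) ts)"
proof -
  have "e x \<in> set (map (val charted_model e) ts)" if "Var x \<in> set ts" for x
    using that by (metis image_eqI set_map val.simps(1))
  then show ?thesis by (auto simp: in_fv_Rel_iff simp del: fv.simps)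
qed

lemma val_charted_model:
  assumes "t \<in> set ts" "consts_fm (Rel R ts) \<subseteq> C"
  shows "val charted_model e t \<in> e ` fv (Rel R ts) \<union> K"
    and "h \<in> placements \<Longrightarrow> h (val charted_model e t) = val A (h \<circ> e) t"
proof -
  have "(val charted_model e t \<in> e ` fv (Rel R ts) \<union> K) \<and>
      (h \<in> placements \<longrightarrow> h (val charted_model e t) = val A (h \<circ> e) t)"
  proof (cases t)
    case (Var x)
    then have "x \<in> fv (Rel R ts)" using assms(1) by (simp only: in_fv_Rel_iff)
    then show ?thesis using Var by (simp del: fv.simps)
  next
    case (Const c)
    then have "c \<in> consts_fm (Rel R ts)" using assms(1) by force
    then have "c \<in> C" using assms(2) by blast
    then show ?thesis using Const by (simp add: const_of_charted_model placement_cst)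
  qed
  then show "val charted_model e t \<in> e ` fv (Rel R ts) \<union> K"
    "h \<in> placements \<Longrightarrow> h (val charted_model e t) = val A (h \<circ> e) t" by simp_all
qed

lemma coherent_if_sat_Rel:
  assumes "sat charted_model e (Rel R ts)"
  shows "coherent (e ` fv (Rel R ts) \<inter> V)"
proof -
  have "coherent (set (map (val charted_model e) ts) \<inter> V)"
    using assms unfolding sat_charted_model_Rel Let_def by blast
  then show ?thesis using fv_Rel_image_subset by (rule coherent_subset[OF _ Int_mono]) simp
qed

lemma coherent_if_sat_guarded:
  assumes "guarded \<theta> \<or> card (fv \<theta>) \<le> 2" "sat charted_model e \<theta>"
  shows "coherent (e ` fv \<theta> \<inter> V)"
  using assms(1)
proof
  assume "guarded \<theta>"
  then obtain R ts e' where e': "sat charted_model e' (Rel R ts)"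
    "fv \<theta> \<subseteq> fv (Rel R ts)" "\<forall>x\<in>fv \<theta>. e' x = e x"
    using sat_guarded assms(2) by blast
  have "e ` fv \<theta> = e' ` fv \<theta>" using e'(3) by simp
  also have "\<dots> \<subseteq> e' ` fv (Rel R ts)" using e'(2) by (rule image_mono)
  finally have "e ` fv \<theta> \<inter> V \<subseteq> e' ` fv (Rel R ts) \<inter> V" by (rule Int_mono) simp
  with coherent_if_sat_Rel[OF e'(1)] show ?thesis by (rule coherent_subset)
next
  assume "card (fv \<theta>) \<le> 2"
  moreover have "card (e ` fv \<theta> \<inter> V) \<le> card (e ` fv \<theta>)" using finite_fv by (intro card_mono) auto
  moreover have "card (e ` fv \<theta>) \<le> card (fv \<theta>)" using finite_fv by (rule card_image_le)
  ultimately show ?thesis by (intro coherent_if_card_le_2) auto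
qed

definition transfers :: "fm \<Rightarrow> bool" where
  "transfers \<psi> \<longleftrightarrow> (\<forall>S e. coherent S \<longrightarrow> e ` fv \<psi> \<subseteq> S \<union> K \<longrightarrow>
     (sat charted_model e \<psi> \<longleftrightarrow> sat A (chart S \<circ> e) \<psi>))"

definition type_determined :: "fm \<Rightarrow> bool" where
  "type_determined \<psi> \<longleftrightarrow> (\<forall>S h h' e. type_over S h = type_over S h' \<longrightarrow> e ` fv \<psi> \<subseteq> S \<union> K \<longrightarrow>
     (sat A (h \<circ> e) \<psi> \<longleftrightarrow> sat A (h' \<circ> e) \<psi>))"

lemma transfersD:
  "transfers \<psi> \<Longrightarrow> coherent S \<Longrightarrow> e ` fv \<psi> \<subseteq> S \<union> K \<Longrightarrow> sat charted_model e \<psi> \<longleftrightarrow> sat A (chart S \<circ> e) \<psi>"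
  by (simp add: transfers_def)

lemma type_determinedD:
  "type_determined \<psi> \<Longrightarrow> type_over S h = type_over S h' \<Longrightarrow> e ` fv \<psi> \<subseteq> S \<union> K \<Longrightarrow>
    sat A (h \<circ> e) \<psi> \<longleftrightarrow> sat A (h' \<circ> e) \<psi>"
  unfolding type_determined_def by blast

lemma type_determined_if_in_F: "\<psi> \<in> F \<Longrightarrow> type_determined \<psi>"
  unfolding type_determined_def type_over_def fm_type_eq_iff by blast

lemma type_determined_Neg: "type_determined (Neg \<psi>) \<longleftrightarrow> type_determined \<psi>"
  by (simp only: type_determined_def fv.simps sat.simps simp_thms)

lemma type_determined_Exists_Neg:
  "type_determined (Exists x (Neg \<psi>)) \<longleftrightarrow> type_determined (Forall x \<psi>)"
  by (simp only: type_determined_def sat_Forall_iff fv.simps simp_thms)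

lemma transfers_Exists_Neg: "transfers (Exists x (Neg \<psi>)) \<longleftrightarrow> transfers (Forall x \<psi>)"
  by (simp only: transfers_def sat_Forall_iff fv.simps simp_thms)

lemma transfersI:
  assumes "type_determined \<psi>"
    and "\<And>e. coherent (e ` fv \<psi> \<inter> V) \<Longrightarrow> e ` fv \<psi> \<subseteq> V \<union> K \<Longrightarrow>
      sat charted_model e \<psi> \<longleftrightarrow> sat A (chart (e ` fv \<psi> \<inter> V) \<circ> e) \<psi>"
  shows "transfers \<psi>"
  unfolding transfers_def
proof (intro allI impI)
  fix S e assume S: "coherent S" and e: "e ` fv \<psi> \<subseteq> S \<union> K"
  let ?T = "e ` fv \<psi> \<inter> V"
  have "S \<subseteq> V" using S by (simp add: coherent_def)
  have "?T \<subseteq> (S \<union> K) \<inter> V" using e by (rule Int_mono) simp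
  also have "\<dots> \<subseteq> S" using cst_notin_V by auto
  finally have "?T \<subseteq> S" .
  have e_T: "e ` fv \<psi> \<subseteq> ?T \<union> K" using e \<open>S \<subseteq> V\<close> by auto
  have "sat charted_model e \<psi> \<longleftrightarrow> sat A (chart ?T \<circ> e) \<psi>"
    using assms(2) coherent_subset[OF S \<open>?T \<subseteq> S\<close>] e_T by blast
  also have "\<dots> \<longleftrightarrow> sat A (chart S \<circ> e) \<psi>"
    using S \<open>?T \<subseteq> S\<close> by (intro type_determinedD[OF assms(1) _ e_T]) (simp add: coherent_def)
  finally show "sat charted_model e \<psi> \<longleftrightarrow> sat A (chart S \<circ> e) \<psi>" .
qed

lemma transfers_Rel:
  assumes "Rel R ts \<in> F" and C: "consts_fm (Rel R ts) \<subseteq> C"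
  shows "transfers (Rel R ts)"
proof (rule transfersI)
  fix e :: "var \<Rightarrow> 'b" let ?X = "e ` fv (Rel R ts)"
  assume coherent_T: "coherent (?X \<inter> V)" and X: "?X \<subseteq> V \<union> K"
  have vals: "set (map (val charted_model e) ts) \<subseteq> ?X \<union> K"
    using val_charted_model(1)[OF _ C, of _ e] by (simp add: image_subset_iff del: fv.simps)
  then have "set (map (val charted_model e) ts) \<subseteq> V \<union> K" using X by blast
  moreover have "set (map (val charted_model e) ts) \<inter> V = ?X \<inter> V"
    using vals fv_Rel_image_subset[of e R ts] cst_notin_V by blast
  moreover have "map (chart (?X \<inter> V)) (map (val charted_model e) ts) =
      map (val A (chart (?X \<inter> V) \<circ> e)) ts"
    using val_charted_model(2)[OF _ C chart_placement[of "?X \<inter> V"], of _ e] by simp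
  ultimately show "sat charted_model e (Rel R ts) \<longleftrightarrow> sat A (chart (?X \<inter> V) \<circ> e) (Rel R ts)"
    using coherent_T unfolding sat_charted_model_Rel Let_def by (simp only: sat.simps simp_thms)
qed (rule type_determined_if_in_F[OF assms(1)])

lemma sat_Exists_if_sat_charted_model:
  assumes \<theta>: "transfers \<theta>" "guarded \<theta> \<or> card (fv \<theta>) \<le> 2" and det: "type_determined (Exists x \<theta>)"
    and e: "e ` fv (Exists x \<theta>) \<subseteq> V \<union> K" and sat: "sat charted_model e (Exists x \<theta>)"
  shows "sat A (chart (e ` fv (Exists x \<theta>) \<inter> V) \<circ> e) (Exists x \<theta>)"
proof -
  let ?T = "e ` fv (Exists x \<theta>) \<inter> V"
  obtain b where b: "b \<in> V \<union> K" "sat charted_model (e(x := b)) \<theta>"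
    using sat by (auto simp: universe_charted_model)
  define S where "S = e(x := b) ` fv \<theta> \<inter> V"
  have S: "coherent S" unfolding S_def using \<theta>(2) b(2) by (rule coherent_if_sat_guarded)
  have "e(x := b) ` fv \<theta> \<subseteq> S \<union> K" using b(1) e by (auto simp: S_def)
  then have "sat A (chart S \<circ> e(x := b)) \<theta>" using transfersD[OF \<theta>(1) S] b(2) by simp
  moreover have "chart S \<circ> e(x := b) = (chart S \<circ> e)(x := chart S b)" by auto
  moreover have "chart S b \<in> universe A"
    using S chart_placement placement_in_universe by (simp add: coherent_def)
  ultimately have "sat A (chart S \<circ> e) (Exists x \<theta>)" by auto
  moreover have "?T \<subseteq> S" by (auto simp: S_def)
  then have "type_over ?T (chart S) = type_over ?T (chart ?T)" using S by (simp add: coherent_def)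
  moreover have "e ` fv (Exists x \<theta>) \<subseteq> ?T \<union> K" using e by blast
  ultimately show ?thesis using type_determinedD[OF det] by blast
qed

lemma sat_charted_model_Exists_if_sat:
  assumes \<theta>: "transfers \<theta>" "type_determined \<theta>" and T: "coherent T" "card T \<le> k"
    and e: "e ` fv (Exists x \<theta>) \<subseteq> T \<union> K" and sat: "sat A (chart T \<circ> e) (Exists x \<theta>)"
  shows "sat charted_model e (Exists x \<theta>)"
proof -
  obtain a where a: "a \<in> universe A" "sat A ((chart T \<circ> e)(x := a)) \<theta>" using sat by auto
  obtain b where b: "b \<in> V - T" "coherent (insert b T)"
    "type_over (insert b T) (chart (insert b T)) = type_over (insert b T) ((chart T)(b := a))"
    using coherent_extension[OF T a(1)] .
  have e_upd: "e(x := b) ` fv \<theta> \<subseteq> insert b T \<union> K" using e by auto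
  have "((chart T \<circ> e)(x := a)) y = ((chart T)(b := a) \<circ> e(x := b)) y" if "y \<in> fv \<theta>" for y
  proof (cases "y = x")
    case False
    then have "e y \<in> T \<union> K" using that e by auto
    then have "e y \<noteq> b" using b(1) cst_notin_V by auto
    then show ?thesis using False by simp
  qed simp
  then have "sat A ((chart T)(b := a) \<circ> e(x := b)) \<theta>" using a(2) sat_cong by blast
  then have "sat A (chart (insert b T) \<circ> e(x := b)) \<theta>"
    using type_determinedD[OF \<theta>(2) b(3) e_upd] by simp
  then have "sat charted_model (e(x := b)) \<theta>" using transfersD[OF \<theta>(1) b(2) e_upd] by simp
  then show ?thesis using b(1) by (auto simp: universe_charted_model)
qed

lemma transfers_Exists:
  assumes \<theta>: "transfers \<theta>" "type_determined \<theta>" "guarded \<theta> \<or> card (fv \<theta>) \<le> 2"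
    and det: "type_determined (Exists x \<theta>)" and card: "card (fv (Exists x \<theta>)) \<le> k"
  shows "transfers (Exists x \<theta>)"
proof (rule transfersI[OF det])
  fix e let ?T = "e ` fv (Exists x \<theta>) \<inter> V"
  assume coherent_T: "coherent ?T" and e: "e ` fv (Exists x \<theta>) \<subseteq> V \<union> K"
  have "card ?T \<le> card (e ` fv (Exists x \<theta>))"
    using finite_fv by (intro card_mono finite_imageI) auto
  also have "\<dots> \<le> k" using card card_image_le[OF finite_fv] order_trans by blast
  finally have "card ?T \<le> k" .
  moreover have "e ` fv (Exists x \<theta>) \<subseteq> ?T \<union> K" using e by blast
  ultimately show "sat charted_model e (Exists x \<theta>) \<longleftrightarrow> sat A (chart ?T \<circ> e) (Exists x \<theta>)"
    using sat_Exists_if_sat_charted_model[OF \<theta>(1,3) det e]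
      sat_charted_model_Exists_if_sat[OF \<theta>(1,2) coherent_T] by blast
qed

lemma transfers_triguarded:
  assumes "triguarded \<psi>" "subfms \<psi> \<subseteq> F" "consts_fm \<psi> \<subseteq> C" "\<And>\<theta>. \<theta> \<in> F \<Longrightarrow> card (fv \<theta>) \<le> k"
  shows "transfers \<psi>"
  using assms(1-3)
proof (induction \<psi>)
  case (Rel R ts)
  then show ?case by (intro transfers_Rel) auto
next
  case (Exists x \<theta>)
  then have F: "\<theta> \<in> F" "Exists x \<theta> \<in> F" using subfms_refl by auto
  then show ?case
    using Exists assms(4)[OF F(2)] by (intro transfers_Exists type_determined_if_in_F) auto
next
  case (Forall x \<theta>)
  then have F: "\<theta> \<in> F" "Forall x \<theta> \<in> F" using subfms_refl by auto
  have "transfers (Exists x (Neg \<theta>))"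
  proof (rule transfers_Exists)
    show "transfers (Neg \<theta>)" using Forall by (simp add: transfers_def)
    show "type_determined (Neg \<theta>)" "type_determined (Exists x (Neg \<theta>))"
      using F
      by (simp_all add: type_determined_if_in_F type_determined_Neg type_determined_Exists_Neg)
  qed (use Forall assms(4)[OF F(2)] in auto)
  then show ?case by (simp only: transfers_Exists_Neg)
qed (simp_all add: transfers_def image_Un)

lemma is_model_charted_model:
  assumes "is_model ar A \<phi>" "sentence \<phi>" "transfers \<phi>"
  shows "is_model ar charted_model \<phi>"
proof -
  have "sat charted_model e \<phi>" for e
  proof -
    have "coherent {}" by (simp add: coherent_if_card_le_2)
    then have "chart {} \<in> placements" by (simp add: chart_placement)
    then have "range (chart {} \<circ> e) \<subseteq> universe A" using placement_in_universe by auto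
    then have "sat A (chart {} \<circ> e) \<phi>" using assms(1) by (simp add: is_model_def)
    then show ?thesis
      using transfersD[OF assms(3) \<open>coherent {}\<close>, of e] assms(2) by (simp add: sentence_def)
  qed
  then show ?thesis using is_struct_charted_model by (simp add: is_model_def)
qed

lemma finite_universe_charted_model: "finite (universe charted_model)"
  using finite_V finite_C by (simp add: universe_charted_model)

lemma card_universe_charted_model_le: "card (universe charted_model) \<le> card V + card C"
  unfolding universe_charted_model by (rule card_Un_K_le)

end

lemma triguarded_finite_model:
  assumes A: "is_model ar A \<phi>" and \<phi>: "sentence \<phi>" "triguarded \<phi>"
    and card_fv: "\<And>\<psi>. \<psi> \<in> subfms \<phi> \<Longrightarrow> card (fv \<psi>) \<le> k"
    and M: "2 ^ (card (subfms \<phi>) * (k + card (consts_fm \<phi>) + 1) ^ k) \<le> M"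
    and small: "real M * real (N + 1) ^ k * (1 - (1 / real M) ^ 2 ^ k) ^ (N - k) < 1"
  shows "\<exists>B :: nat struct. is_model ar B \<phi> \<and> finite (universe B) \<and>
    card (universe B) \<le> N + card (consts_fm \<phi>)"
proof -
  interpret placement_space ar A "subfms \<phi>" "consts_fm \<phi>" "{..<N}" "(+) N"
    using A by unfold_locales (simp_all add: is_model_def finite_subfms finite_consts_fm)
  obtain d where "extension_property k d"
    using ex_extension_property[OF card_fv M] small by auto
  then interpret proposals ar A "subfms \<phi>" "consts_fm \<phi>" "{..<N}" "(+) N" k d
    by unfold_locales
  have "transfers \<phi>" using \<phi>(2) card_fv by (intro transfers_triguarded) auto
  then have "is_model ar charted_model \<phi>" by (rule is_model_charted_model[OF A \<phi>(1)])
  then show ?thesis using finite_universe_charted_model card_universe_charted_model_le by auto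
qed


section \<open>Estimates\<close>

lemma one_minus_inverse_power_square_le:
  assumes "0 < Q"
  shows "(1 - 1 / real Q) ^ (Q * Q) \<le> (1 / 2) ^ Q"
proof -
  have "2 \<le> exp (1::real)" using exp_ge_add_one_self[of 1] by simp
  then have "exp (- 1) \<le> (1 / 2 :: real)" by (simp add: exp_minus field_simps)
  then have "(1 - 1 / real Q) ^ Q \<le> 1 / 2"
    using exp_ge_one_minus_x_over_n_power_n[of 1 Q] assms by simp
  then have "((1 - 1 / real Q) ^ Q) ^ Q \<le> (1 / 2) ^ Q" using assms by (intro power_mono) auto
  then show ?thesis by (simp add: power_mult)
qed

lemma square_less_two_power: "5 \<le> q \<Longrightarrow> q * q < 2 ^ q" for q :: nat
proof (induction q rule: nat_induct_at_least)
  case (Suc q)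
  have "5 * q \<le> q * q" using Suc.hyps by (intro mult_right_mono) auto
  then have "2 * q + 1 \<le> q * q" using Suc.hyps by linarith
  then have "Suc q * Suc q \<le> 2 * (q * q)" by simp
  then show ?case using Suc.IH by simp
qed simp

lemma union_bound_less_1:
  fixes q k M Q :: nat
  assumes Q: "Q = 2 ^ q" and "M \<le> Q" "q * (3 * k + 1) < Q" "k + 2 \<le> Q"
  shows "real M * real (Q * Q + k + 1) ^ k * (1 - 1 / real Q) ^ (Q * Q) < 1"
proof -
  have "Q * 1 \<le> Q * (Q * (Q - 1))" using assms(4) by (intro mult_left_mono) auto
  then have "Q * Q + Q \<le> Q * Q * Q" using assms(4) by (cases Q) (auto simp: algebra_simps)
  then have "Q * Q + k + 1 \<le> Q ^ 3" using assms(4) by (simp add: power3_eq_cube)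
  then have "M * (Q * Q + k + 1) ^ k \<le> Q * (Q ^ 3) ^ k"
    using assms(2) by (intro mult_mono power_mono) auto
  also have "\<dots> = 2 ^ (q * (3 * k + 1))"
    by (simp add: Q power_add algebra_simps flip: power_mult)
  also have "\<dots> < 2 ^ Q" using assms(3) by (intro power_strict_increasing) auto
  finally have "M * (Q * Q + k + 1) ^ k < 2 ^ Q" .
  then have less: "real M * real (Q * Q + k + 1) ^ k < 2 ^ Q"
    by (metis of_nat_less_iff of_nat_mult of_nat_numeral of_nat_power)
  have "real M * real (Q * Q + k + 1) ^ k * (1 - 1 / real Q) ^ (Q * Q)
      \<le> real M * real (Q * Q + k + 1) ^ k * (1 / 2) ^ Q"
    using one_minus_inverse_power_square_le[of Q] assms(4) by (intro mult_left_mono) auto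
  also have "\<dots> < 2 ^ Q * (1 / 2) ^ Q" using less by (intro mult_strict_right_mono) auto
  also have "\<dots> = 1" by (simp add: power_mult_distrib[symmetric])
  finally show ?thesis .
qed

definition type_exponent :: "nat \<Rightarrow> nat" where
  "type_exponent n = n ^ (2 * n + 1)"

lemma type_exponent_two_power_bounds:
  assumes "3 \<le> n"
  shows "5 * n \<le> type_exponent n * 2 ^ n"
    and "2 * (type_exponent n * 2 ^ n) + 1 \<le> n ^ (4 * n)"
proof -
  let ?q = "type_exponent n * 2 ^ n"
  have "n ^ 1 \<le> type_exponent n"
    unfolding type_exponent_def using assms by (intro power_increasing) auto
  moreover have "2 ^ 3 \<le> (2::nat) ^ n" using assms by (intro power_increasing) auto
  ultimately have "n * 8 \<le> ?q" by (intro mult_mono) auto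
  then show "5 * n \<le> ?q" by linarith
  then have "2 * ?q + 1 \<le> 3 * ?q" using assms by linarith
  also have "\<dots> \<le> n * (n ^ (2 * n + 1) * n ^ n)"
    unfolding type_exponent_def using assms by (intro mult_mono power_mono) auto
  also have "\<dots> = n ^ (3 * n + 2)" by (simp add: numeral_3_eq_3 flip: power_add power_Suc)
  also have "\<dots> \<le> n ^ (4 * n)" using assms by (intro power_increasing) auto
  finally show "2 * ?q + 1 \<le> n ^ (4 * n)" .
qed

lemma card_types_le_type_exponent:
  fixes n :: nat
  assumes "3 \<le> n" "s \<le> n" "c \<le> n"
  shows "2 ^ (s * (n + c + 1) ^ n) \<le> (2 :: nat) ^ type_exponent n"
proof -
  have "3 * n \<le> n * n" using assms(1) by simp
  then have "n + c + 1 \<le> n * n" using assms by linarith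
  then have "s * (n + c + 1) ^ n \<le> n * (n * n) ^ n"
    using assms by (intro mult_mono power_mono) auto
  also have "\<dots> = type_exponent n"
    by (simp add: type_exponent_def power_mult_distrib power_add mult_2)
  finally show ?thesis by (intro power_increasing) auto
qed

lemma union_bound_type_exponent:
  fixes n :: nat
  assumes "3 \<le> n"
  defines "M \<equiv> 2 ^ type_exponent n" and "Q \<equiv> 2 ^ (type_exponent n * 2 ^ n)"
  shows "real M * real (Q * Q + n + 1) ^ n * (1 - (1 / real M) ^ 2 ^ n) ^ (Q * Q) < 1"
    and "2 * n \<le> Q * Q"
proof -
  define q where "q = type_exponent n * 2 ^ n"
  have Q: "Q = 2 ^ q" by (simp add: Q_def q_def)
  have q: "5 * n \<le> q" using type_exponent_two_power_bounds(1)[OF assms(1)] by (simp add: q_def)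
  have "q * (3 * n + 1) \<le> q * q" using q assms(1) by (intro mult_left_mono) auto
  also have "\<dots> < Q" unfolding Q using q assms(1) by (intro square_less_two_power) simp
  finally have "q * (3 * n + 1) < Q" .
  moreover have "5 * n < Q" unfolding Q using q less_exp by (rule le_less_trans)
  moreover have "M \<le> Q" unfolding M_def Q_def by (intro power_increasing) auto
  ultimately have "real M * real (Q * Q + n + 1) ^ n * (1 - 1 / real Q) ^ (Q * Q) < 1"
    using assms(1) by (intro union_bound_less_1[OF Q]) auto
  moreover have "(1 / real M) ^ 2 ^ n = 1 / real Q"
    by (simp add: M_def Q_def power_mult power_one_over)
  ultimately show "real M * real (Q * Q + n + 1) ^ n * (1 - (1 / real M) ^ 2 ^ n) ^ (Q * Q) < 1"
    by simp
  show "2 * n \<le> Q * Q" using \<open>5 * n < Q\<close> le_square[of Q] by linarith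
qed

lemma triguarded_finite_model_card_le:
  assumes "is_model ar A \<phi>" "sentence \<phi>" "triguarded \<phi>"
  defines "n \<equiv> fm_length \<phi>"
  shows "\<exists>B :: nat struct. is_model ar B \<phi> \<and> finite (universe B) \<and>
    card (universe B) \<le> 2 ^ n ^ (4 * n)"
proof -
  define q where "q = type_exponent n * 2 ^ n"
  define Q :: nat where "Q = 2 ^ q"
  have n: "3 \<le> n" by (simp add: n_def fm_length_ge_3)
  have card_fv: "card (fv \<psi>) \<le> n" if "\<psi> \<in> subfms \<phi>" for \<psi>
    using card_fv_le[of \<psi>] fm_length_subfms_le[OF that] by (simp add: n_def)
  have "2 ^ (card (subfms \<phi>) * (n + card (consts_fm \<phi>) + 1) ^ n) \<le> (2::nat) ^ type_exponent n"
    using n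
    by (intro card_types_le_type_exponent) (simp_all add: n_def card_subfms_le card_consts_fm_le)
  from triguarded_finite_model[OF assms(1-3) card_fv this, of "Q * Q + n"]
  obtain B :: "nat struct" where B: "is_model ar B \<phi>" "finite (universe B)"
    and card_B: "card (universe B) \<le> Q * Q + n + card (consts_fm \<phi>)"
    using union_bound_type_exponent(1)[OF n] by (auto simp: Q_def q_def)
  note card_B
  also have "Q * Q + n + card (consts_fm \<phi>) \<le> Q * Q + 2 * n"
    using card_consts_fm_le[of \<phi>] by (simp add: n_def)
  also have "\<dots> \<le> Q * Q + Q * Q"
    using union_bound_type_exponent(2)[OF n] by (simp add: Q_def q_def)
  also have "\<dots> = 2 ^ (2 * q + 1)" by (simp add: Q_def power_add mult_2)
  also have "\<dots> \<le> 2 ^ n ^ (4 * n)"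
    using type_exponent_two_power_bounds(2)[OF n] by (intro power_increasing) (simp_all add: q_def)
  finally show ?thesis using B by blast
qed

lemma two_power_power_eq_powr:
  assumes "0 < n"
  shows "(2::real) ^ n ^ (c * n) = 2 powr (2 powr (real c * real n * log 2 (real n)))"
proof -
  have "2 powr (real c * real n * log 2 (real n)) = (2 powr log 2 (real n)) powr real (c * n)"
    by (simp add: powr_powr mult_ac)
  also have "\<dots> = real n powr real (c * n)" using assms by simp
  also have "\<dots> = real n ^ (c * n)" using assms by (intro powr_realpow) simp
  finally have "2 powr (real c * real n * log 2 (real n)) = real (n ^ (c * n))" by simp
  then show ?thesis by (simp only: powr_realpow zero_less_numeral)
qed

theorem theorem4:
  shows "\<exists>C::real. C > 0 \<and>
    (\<forall>(ar :: nat \<Rightarrow> nat) (\<phi> :: fm).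
       respects_arity ar \<phi> \<longrightarrow> \<phi> \<in> TGF \<longrightarrow> equality_free \<phi> \<longrightarrow> sentence \<phi> \<longrightarrow>
       satisfiable ar \<phi> \<longrightarrow>
       (\<exists>M :: nat struct. is_model ar M \<phi> \<and> finite (universe M) \<and>
          real (card (universe M)) \<le>
            2 powr (2 powr (C * real (fm_length \<phi>) * log 2 (real (fm_length \<phi>))))))"
proof (intro exI[of _ 4] conjI allI impI)
  fix ar \<phi>
  assume "\<phi> \<in> TGF" "equality_free \<phi>" "sentence \<phi>" "satisfiable ar \<phi>"
  then obtain A :: "nat struct" where "is_model ar A \<phi>" "sentence \<phi>" "triguarded \<phi>"
    using triguarded_if_TGF by (auto simp: satisfiable_def)
  then obtain M :: "nat struct" where M: "is_model ar M \<phi>" "finite (universe M)"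
    and "card (universe M) \<le> 2 ^ fm_length \<phi> ^ (4 * fm_length \<phi>)"
    using triguarded_finite_model_card_le by blast
  then have "real (card (universe M)) \<le> 2 ^ fm_length \<phi> ^ (4 * fm_length \<phi>)"
    by (metis of_nat_le_iff of_nat_numeral of_nat_power)
  also have "\<dots> = 2 powr (2 powr (4 * real (fm_length \<phi>) * log 2 (real (fm_length \<phi>))))"
    using two_power_power_eq_powr[of "fm_length \<phi>" 4] fm_length_ge_3[of \<phi>] by simp
  finally show "\<exists>M :: nat struct. is_model ar M \<phi> \<and> finite (universe M) \<and>
      real (card (universe M)) \<le>
        2 powr (2 powr (4 * real (fm_length \<phi>) * log 2 (real (fm_length \<phi>))))"
    using M by blast
qed simp

end
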